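(* Let $m\ge2$. The maps $p\mapsto\mathfrak{F}_p$ and $p\mapsto\mathfrak{F}^{\mathrm{convex}}_p$ are left-continuous on $(1,\infty]$; in particular $\lim_{p\uparrow\infty}\mathfrak{F}_p=\mathfrak{F}_\infty$.
   Context: For a non-empty open $\Omega\subset\mathbb{R}^m$ with $|\Omega|<\infty$, $\lambda_1(\Omega)=\inf_{\varphi\in H_0^1(\Omega)\setminus\{0\}}\int_\Omega|D\varphi|^2/\int_\Omega\varphi^2$, $v_\Omega$ is the unique solution of $-\Delta v=1$, $v\in H_0^1(\Omega)$, $F_p(\Omega)=\|v_\Omega\|_{L^p(\Omega)}\lambda_1(\Omega)/|\Omega|^{1/p}$ for $1\le p<\infty$, and $F_\infty(\Omega)=\|v_\Omega\|_{L^\infty(\Omega)}\lambda_1(\Omega)$. For $1\le p\le\infty$: $\mathfrak{F}_p=\sup\{F_p(\Omega):\Omega\text{ open in }\mathbb{R}^m,\ 0<|\Omega|<\infty\}$ and $\mathfrak{F}^{\mathrm{convex}}_p=\sup\{F_p(\Omega):\Omega\text{ open, convex in }\mathbb{R}^m,\ 0<|\Omega|<\infty\}$. *)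

theory Defs
  imports "HOL-Analysis.Analysis" "HOL-Probability.Essential_Supremum"
begin

coinductive smooth_fun :: "('a::euclidean_space \<Rightarrow> real) \<Rightarrow> bool" where
  "\<lbrakk> f differentiable_on UNIV; continuous_on UNIV f;
     \<forall>b\<in>Basis. smooth_fun (\<lambda>x. frechet_derivative f (at x) b) \<rbrakk> \<Longrightarrow> smooth_fun f"

definition grad :: "('a::euclidean_space \<Rightarrow> real) \<Rightarrow> 'a \<Rightarrow> 'a" where
  "grad f x = (\<Sum>b\<in>Basis. frechet_derivative f (at x) b *\<^sub>R b)"

definition test_fun :: "'a::euclidean_space set \<Rightarrow> ('a \<Rightarrow> real) \<Rightarrow> bool" where
  "test_fun \<Omega> \<phi> \<longleftrightarrow> smooth_fun \<phi> \<and> compact (closure {x. \<phi> x \<noteq> 0})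
      \<and> closure {x. \<phi> x \<noteq> 0} \<subseteq> \<Omega>"

text \<open>\<open>H01 \<Omega> u G\<close>: u belongs to H_0^1(\<Omega>) with (weak) gradient G, i.e. there are test functions
  \<phi>_k with \<phi>_k \<rightarrow> u and D\<phi>_k \<rightarrow> G in L^2(\<Omega>).\<close>
definition H01 :: "'a::euclidean_space set \<Rightarrow> ('a \<Rightarrow> real) \<Rightarrow> ('a \<Rightarrow> 'a) \<Rightarrow> bool" where
  "H01 \<Omega> u G \<longleftrightarrow> u \<in> borel_measurable lebesgue \<and> G \<in> borel_measurable lebesgue \<and>
     (\<exists>\<phi>::nat \<Rightarrow> 'a \<Rightarrow> real. (\<forall>k. test_fun \<Omega> (\<phi> k)) \<and>
        ((\<lambda>k. \<integral>\<^sup>+ x\<in>\<Omega>. ennreal ((u x - \<phi> k x)\<^sup>2) \<partial>lebesgue) \<longlonglongrightarrow> 0) \<and>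
        ((\<lambda>k. \<integral>\<^sup>+ x\<in>\<Omega>. ennreal ((norm (G x - grad (\<phi> k) x))\<^sup>2) \<partial>lebesgue) \<longlonglongrightarrow> 0))"

definition lambda1 :: "'a::euclidean_space set \<Rightarrow> real" where
  "lambda1 \<Omega> = Inf {(LINT x:\<Omega>|lebesgue. (norm (G x))\<^sup>2) / (LINT x:\<Omega>|lebesgue. (u x)\<^sup>2) | u G.
      H01 \<Omega> u G \<and> (LINT x:\<Omega>|lebesgue. (u x)\<^sup>2) \<noteq> 0}"

text \<open>The torsion function: the (a.e. unique) weak solution v \<in> H_0^1(\<Omega>) of -\<Delta>v = 1.\<close>
definition torsion :: "'a::euclidean_space set \<Rightarrow> 'a \<Rightarrow> real" where
  "torsion \<Omega> = (SOME v. \<exists>G. H01 \<Omega> v G \<and>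
      (\<forall>\<phi>. test_fun \<Omega> \<phi> \<longrightarrow>
         (LINT x:\<Omega>|lebesgue. G x \<bullet> grad \<phi> x) = (LINT x:\<Omega>|lebesgue. \<phi> x)))"

definition Lp_norm :: "real \<Rightarrow> 'a::euclidean_space set \<Rightarrow> ('a \<Rightarrow> real) \<Rightarrow> real" where
  "Lp_norm p \<Omega> v = (LINT x:\<Omega>|lebesgue. \<bar>v x\<bar> powr p) powr (1 / p)"

definition Linf_norm :: "'a::euclidean_space set \<Rightarrow> ('a \<Rightarrow> real) \<Rightarrow> real" where
  "Linf_norm \<Omega> v = real_of_ereal (esssup lebesgue (\<lambda>x. ereal (indicator \<Omega> x * \<bar>v x\<bar>)))"

definition Ffun :: "ereal \<Rightarrow> 'a::euclidean_space set \<Rightarrow> real" where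
  "Ffun p \<Omega> = (if p = \<infinity> then Linf_norm \<Omega> (torsion \<Omega>) * lambda1 \<Omega>
     else Lp_norm (real_of_ereal p) \<Omega> (torsion \<Omega>) * lambda1 \<Omega>
            / measure lebesgue \<Omega> powr (1 / real_of_ereal p))"

definition Frak :: "'a::euclidean_space itself \<Rightarrow> ereal \<Rightarrow> ereal" where
  "Frak _ p = (SUP \<Omega>\<in>{\<Omega>::'a set. open \<Omega> \<and> 0 < emeasure lebesgue \<Omega> \<and> emeasure lebesgue \<Omega> < \<infinity>}.
                 ereal (Ffun p \<Omega>))"

definition Frak_convex :: "'a::euclidean_space itself \<Rightarrow> ereal \<Rightarrow> ereal" where
  "Frak_convex _ p = (SUP \<Omega>\<in>{\<Omega>::'a set. open \<Omega> \<and> convex \<Omega> \<and> 0 < emeasure lebesgue \<Omega>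
                 \<and> emeasure lebesgue \<Omega> < \<infinity>}. ereal (Ffun p \<Omega>))"

end

theory Submission
  imports Defs "HOL-Probability.Probability_Measure"
begin

text \<open>
  For a fixed set the factor of \<open>F\<^sub>p\<close> depending on \<open>p\<close> is the \<open>L\<^sup>p\<close> norm of the torsion function
  with respect to normalised Lebesgue measure. It is nondecreasing and left-continuous in \<open>p\<close>
  (up to and including \<open>p = \<infinity>\<close>) as soon as the torsion function is bounded, and a supremum of
  nondecreasing left-continuous functions is again left-continuous.

  Existence and boundedness of the torsion function on an arbitrary open set of finite measure both
  rest on the Nash type inequality
  \<open>\<integral> f\<^sup>2 \<le> (\<integral> \<bar>f\<bar>)\<^sup>2 / \<bar>B\<^sub>R\<bar> + R\<^sup>2/2 \<integral> \<bar>Df\<bar>\<^sup>2\<close>, obtained by averaging the squared increments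
  \<open>(f(x+h) - f(x))\<^sup>2\<close> over the ball \<open>B\<^sub>R\<close>. Taking \<open>\<bar>B\<^sub>R\<bar> > 2 \<bar>\<Omega>\<bar>\<close> it gives the Poincare
  inequality, hence a convergent minimising sequence of test functions for the torsion energy.
  Applied to truncations \<open>(v - k)\<^sup>+\<close> of a solution it shows that raising the level \<open>k\<close> by
  \<open>C b\<^sup>2\<^sup>/\<^sup>m\<close> halves the bound \<open>b\<close> on the measure of \<open>{v > k}\<close>; since these increments form a
  geometric series, \<open>v\<close> is bounded.
\<close>

section \<open>Square integrable functions\<close>

definition square_integrable ::
    "'a measure \<Rightarrow> ('a \<Rightarrow> 'b::{real_inner, second_countable_topology}) \<Rightarrow> bool" where
  "square_integrable M f \<longleftrightarrow> f \<in> borel_measurable M \<and> integrable M (\<lambda>x. (norm (f x))\<^sup>2)"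

definition L2_norm :: "'a measure \<Rightarrow> ('a \<Rightarrow> 'b::real_normed_vector) \<Rightarrow> real" where
  "L2_norm M f = sqrt (\<integral>x. (norm (f x))\<^sup>2 \<partial>M)"

lemma square_integrable_measurable [measurable_dest]:
  "square_integrable M f \<Longrightarrow> f \<in> borel_measurable M"
  by (simp add: square_integrable_def)

lemma square_integrableD:
  "square_integrable M f \<Longrightarrow> integrable M (\<lambda>x. (norm (f x))\<^sup>2)"
  by (simp add: square_integrable_def)

lemma L2_norm_nonneg [simp]: "0 \<le> L2_norm M f"
  by (simp add: L2_norm_def)

lemma L2_norm_power2: "(L2_norm M f)\<^sup>2 = (\<integral>x. (norm (f x))\<^sup>2 \<partial>M)"
  by (simp add: L2_norm_def)

lemma L2_norm_power2_inner: "(L2_norm M f)\<^sup>2 = (\<integral>x. f x \<bullet> f x \<partial>M)"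
  by (simp add: L2_norm_power2 power2_norm_eq_inner)

lemma square_integrable_cong:
  "(\<And>x. x \<in> space M \<Longrightarrow> f x = g x) \<Longrightarrow> square_integrable M f \<longleftrightarrow> square_integrable M g"
  unfolding square_integrable_def
  by (intro arg_cong2[where f = "(\<and>)"] measurable_cong Bochner_Integration.integrable_cong) auto

lemma L2_norm_cong: "(\<And>x. x \<in> space M \<Longrightarrow> f x = g x) \<Longrightarrow> L2_norm M f = L2_norm M g"
  unfolding L2_norm_def by (auto cong: Bochner_Integration.integral_cong)

lemma L2_norm_minus_commute: "L2_norm M (\<lambda>x. f x - g x) = L2_norm M (\<lambda>x. g x - f x)"
  by (simp add: L2_norm_def norm_minus_commute)

lemma nn_integral_eq_L2_norm:
  assumes "square_integrable M f"
  shows "(\<integral>\<^sup>+x. ennreal ((norm (f x))\<^sup>2) \<partial>M) = ennreal ((L2_norm M f)\<^sup>2)"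
  unfolding L2_norm_power2 using square_integrableD[OF assms] by (rule nn_integral_eq_integral) simp

lemma square_integrable_iff_nn_integral:
  "square_integrable M f \<longleftrightarrow>
    f \<in> borel_measurable M \<and> (\<integral>\<^sup>+x. ennreal ((norm (f x))\<^sup>2) \<partial>M) < \<infinity>"
  unfolding square_integrable_def by (auto simp: integrable_iff_bounded)

lemma square_integrable_bound:
  fixes f :: "'a \<Rightarrow> 'b::{real_inner, second_countable_topology}"
    and g :: "'a \<Rightarrow> 'c::{real_inner, second_countable_topology}"
  assumes "square_integrable M f" "g \<in> borel_measurable M" "AE x in M. norm (g x) \<le> norm (f x)"
  shows "square_integrable M g"
  unfolding square_integrable_def
proof
  show "integrable M (\<lambda>x. (norm (g x))\<^sup>2)"
  proof (rule Bochner_Integration.integrable_bound[OF square_integrableD[OF assms(1)]])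
    show "AE x in M. norm ((norm (g x))\<^sup>2) \<le> norm ((norm (f x))\<^sup>2)"
      using assms(3) by eventually_elim (simp add: power_mono)
  qed (use assms(2) in simp)
qed fact

lemma L2_norm_mono:
  fixes f :: "'a \<Rightarrow> 'b::{real_inner, second_countable_topology}"
    and g :: "'a \<Rightarrow> 'c::{real_inner, second_countable_topology}"
  assumes "square_integrable M f" "g \<in> borel_measurable M" "AE x in M. norm (g x) \<le> norm (f x)"
  shows "L2_norm M g \<le> L2_norm M f"
  unfolding L2_norm_def
proof (rule real_sqrt_le_mono, rule integral_mono_AE)
  show "AE x in M. (norm (g x))\<^sup>2 \<le> (norm (f x))\<^sup>2"
    using assms(3) by eventually_elim (simp add: power_mono)
qed (use assms(1) square_integrable_bound[OF assms] in \<open>simp_all add: square_integrable_def\<close>)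

lemma (in finite_measure) square_integrable_bounded:
  assumes [measurable]: "f \<in> borel_measurable M" and B: "\<And>x. norm (f x) \<le> B"
  shows "square_integrable M f"
  unfolding square_integrable_def
  by (intro conjI integrable_const_bound[of _ "B\<^sup>2"]) (auto intro!: power_mono B)

lemma square_integrable_norm:
  "square_integrable M f \<Longrightarrow> square_integrable M (\<lambda>x. norm (f x))"
  by (rule square_integrable_bound[of M f]) simp_all

lemma square_integrable_scaleR:
  assumes [measurable]: "square_integrable M f"
  shows "square_integrable M (\<lambda>x. c *\<^sub>R f x)"
  using square_integrableD[OF assms] by (simp add: square_integrable_def power_mult_distrib)

lemma square_integrable_add:
  assumes [measurable]: "square_integrable M f" "square_integrable M g"
  shows "square_integrable M (\<lambda>x. f x + g x)"
  unfolding square_integrable_def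
proof
  show "integrable M (\<lambda>x. (norm (f x + g x))\<^sup>2)"
  proof (rule Bochner_Integration.integrable_bound)
    show "integrable M (\<lambda>x. 2 * (norm (f x))\<^sup>2 + 2 * (norm (g x))\<^sup>2)"
      using assms[THEN square_integrableD] by simp
    have "(norm (f x + g x))\<^sup>2 \<le> 2 * (norm (f x))\<^sup>2 + 2 * (norm (g x))\<^sup>2" for x
      using zero_le_power2[of "norm (f x - g x)"]
      by (simp add: power2_norm_eq_inner algebra_simps inner_commute)
    then show "AE x in M. norm ((norm (f x + g x))\<^sup>2)
        \<le> norm (2 * (norm (f x))\<^sup>2 + 2 * (norm (g x))\<^sup>2)"
      by simp
  qed simp
qed simp

lemma square_integrable_diff:
  "square_integrable M f \<Longrightarrow> square_integrable M g \<Longrightarrow> square_integrable M (\<lambda>x. f x - g x)"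
  using square_integrable_add[of M f "\<lambda>x. (- 1) *\<^sub>R g x"] square_integrable_scaleR[of M g "- 1"]
  by simp

lemma integrable_norm_mult:
  assumes [measurable]: "square_integrable M f" "square_integrable M g"
  shows "integrable M (\<lambda>x. norm (f x) * norm (g x))"
proof (rule Bochner_Integration.integrable_bound)
  show "integrable M (\<lambda>x. (norm (f x))\<^sup>2 + (norm (g x))\<^sup>2)"
    using assms[THEN square_integrableD] by simp
  have "norm (f x) * norm (g x) \<le> (norm (f x))\<^sup>2 + (norm (g x))\<^sup>2" for x
    using sum_squares_bound[of "norm (f x)" "norm (g x)"]
      mult_nonneg_nonneg[OF norm_ge_zero norm_ge_zero, of "f x" "g x"] by linarith
  then show "AE x in M. norm (norm (f x) * norm (g x)) \<le> norm ((norm (f x))\<^sup>2 + (norm (g x))\<^sup>2)"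
    by simp
qed simp

lemma integrable_inner:
  assumes [measurable]: "square_integrable M f" "square_integrable M g"
  shows "integrable M (\<lambda>x. f x \<bullet> g x)"
  by (rule Bochner_Integration.integrable_bound[OF integrable_norm_mult[OF assms]])
    (auto simp: Cauchy_Schwarz_ineq2)

lemma integral_norm_mult_le_L2_norm:
  assumes [measurable]: "square_integrable M f" "square_integrable M g"
  shows "(\<integral>x. norm (f x) * norm (g x) \<partial>M) \<le> L2_norm M f * L2_norm M g"
proof -
  let ?I = "\<integral>x. norm (f x) * norm (g x) \<partial>M"
  have "ennreal (?I\<^sup>2) = (\<integral>\<^sup>+x. ennreal (norm (f x)) * ennreal (norm (g x)) \<partial>M)\<^sup>2"
    using nn_integral_eq_integral[OF integrable_norm_mult[OF assms]]
    by (simp add: ennreal_mult[symmetric] ennreal_power)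
  also have "\<dots> \<le> (\<integral>\<^sup>+x. (ennreal (norm (f x)))\<^sup>2 \<partial>M) * (\<integral>\<^sup>+x. (ennreal (norm (g x)))\<^sup>2 \<partial>M)"
    by (rule Cauchy_Schwarz_nn_integral) auto
  also have "\<dots> = ennreal ((L2_norm M f * L2_norm M g)\<^sup>2)"
    using assms by (simp add: ennreal_power nn_integral_eq_L2_norm ennreal_mult power_mult_distrib)
  finally have "?I\<^sup>2 \<le> (L2_norm M f * L2_norm M g)\<^sup>2"
    by (simp add: ennreal_le_iff)
  then show ?thesis by (rule power2_le_imp_le) simp
qed

lemma Cauchy_Schwarz_L2:
  assumes "square_integrable M f" "square_integrable M g"
  shows "\<bar>\<integral>x. f x \<bullet> g x \<partial>M\<bar> \<le> L2_norm M f * L2_norm M g"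
proof -
  have "\<bar>\<integral>x. f x \<bullet> g x \<partial>M\<bar> \<le> (\<integral>x. \<bar>f x \<bullet> g x\<bar> \<partial>M)"
    by (rule integral_abs_bound)
  also have "\<dots> \<le> (\<integral>x. norm (f x) * norm (g x) \<partial>M)"
    using assms
    by (intro integral_mono integrable_abs integrable_inner integrable_norm_mult
        Cauchy_Schwarz_ineq2)
  also note integral_norm_mult_le_L2_norm[OF assms]
  finally show ?thesis .
qed

lemma L2_norm_add_scaleR_power2:
  assumes "square_integrable M f" "square_integrable M g"
  shows "(L2_norm M (\<lambda>x. f x + t *\<^sub>R g x))\<^sup>2
    = (L2_norm M f)\<^sup>2 + 2 * t * (\<integral>x. f x \<bullet> g x \<partial>M) + t\<^sup>2 * (L2_norm M g)\<^sup>2"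
proof -
  have "(norm (f x + t *\<^sub>R g x))\<^sup>2
      = (norm (f x))\<^sup>2 + 2 * t * (f x \<bullet> g x) + t\<^sup>2 * (norm (g x))\<^sup>2" for x
    unfolding power2_norm_eq_inner by (simp add: inner_commute power2_eq_square algebra_simps)
  then show ?thesis
    using assms[THEN square_integrableD] integrable_inner[OF assms] by (simp add: L2_norm_power2)
qed

lemma L2_norm_triangle_ineq:
  assumes "square_integrable M f" "square_integrable M g"
  shows "L2_norm M (\<lambda>x. f x + g x) \<le> L2_norm M f + L2_norm M g"
proof (rule power2_le_imp_le)
  show "(L2_norm M (\<lambda>x. f x + g x))\<^sup>2 \<le> (L2_norm M f + L2_norm M g)\<^sup>2"
    using L2_norm_add_scaleR_power2[OF assms, of 1] Cauchy_Schwarz_L2[OF assms]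
    by (simp add: power2_sum)
qed simp

lemma L2_norm_triangle_ineq3:
  assumes "square_integrable M f" "square_integrable M g"
  shows "\<bar>L2_norm M f - L2_norm M g\<bar> \<le> L2_norm M (\<lambda>x. f x - g x)"
  using L2_norm_triangle_ineq[OF square_integrable_diff[OF assms] assms(2)]
    L2_norm_triangle_ineq[OF square_integrable_diff[OF assms(2,1)] assms(1)]
    L2_norm_minus_commute[of M f g]
  by simp

lemma (in finite_measure) integral_norm_le_L2_norm_support:
  assumes f: "square_integrable M f" and A: "A \<in> sets M"
    and supp: "\<And>x. x \<in> space M \<Longrightarrow> x \<notin> A \<Longrightarrow> f x = 0"
  shows "(\<integral>x. norm (f x) \<partial>M) \<le> sqrt (measure M A) * L2_norm M f"
proof -
  let ?I = "indicator A :: 'a \<Rightarrow> real"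
  have I: "square_integrable M ?I"
    using A by (intro square_integrable_bounded[where B = 1]) (auto simp: indicator_def)
  have "(\<integral>x. norm (f x) \<partial>M) = (\<integral>x. norm (f x) * norm (?I x) \<partial>M)"
    by (rule Bochner_Integration.integral_cong) (auto simp: supp split: split_indicator)
  also have "\<dots> \<le> L2_norm M f * L2_norm M ?I"
    using f I by (rule integral_norm_mult_le_L2_norm)
  also have "(\<integral>x. (norm (?I x))\<^sup>2 \<partial>M) = (\<integral>x. ?I x \<partial>M)"
    by (rule Bochner_Integration.integral_cong) (auto split: split_indicator)
  then have "L2_norm M ?I = sqrt (measure M A)"
    using A sets.sets_into_space[OF A] by (simp add: L2_norm_def Int_absorb2)
  finally show ?thesis by (simp add: mult.commute)
qed

lemma (in finite_measure) integral_norm_le_L2_norm: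
  assumes "square_integrable M f"
  shows "(\<integral>x. norm (f x) \<partial>M) \<le> sqrt (measure M (space M)) * L2_norm M f"
  using assms by (rule integral_norm_le_L2_norm_support) auto

lemma (in finite_measure) square_integrable_imp_integrable_norm:
  assumes "square_integrable M f"
  shows "integrable M (\<lambda>x. norm (f x))"
  using integrable_norm_mult[OF assms square_integrable_bounded[of "\<lambda>_. 1::real" 1]] by simp

abbreviation L2_tendsto ::
    "'a measure \<Rightarrow> (nat \<Rightarrow> 'a \<Rightarrow> 'b::real_normed_vector) \<Rightarrow> ('a \<Rightarrow> 'b) \<Rightarrow> bool" where
  "L2_tendsto M f g \<equiv> (\<lambda>n. L2_norm M (\<lambda>x. f n x - g x)) \<longlonglongrightarrow> 0"

definition L2_Cauchy :: "'a measure \<Rightarrow> (nat \<Rightarrow> 'a \<Rightarrow> 'b::real_normed_vector) \<Rightarrow> bool" where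
  "L2_Cauchy M f \<longleftrightarrow> (\<forall>e>0. \<exists>N. \<forall>m\<ge>N. \<forall>n\<ge>N. L2_norm M (\<lambda>x. f m x - f n x) \<le> e)"

lemma L2_norm_tendsto:
  assumes "\<And>n. square_integrable M (f n)" "square_integrable M g"
    and "L2_tendsto M f g"
  shows "(\<lambda>n. L2_norm M (f n)) \<longlonglongrightarrow> L2_norm M g"
  using assms(1,2)
  by (intro LIM_zero_cancel[OF Lim_null_comparison[OF _ assms(3)]])
    (simp add: L2_norm_triangle_ineq3)

lemma integral_inner_tendsto:
  assumes f: "\<And>n. square_integrable M (f n)" and g: "square_integrable M g"
    and h: "square_integrable M h" and lim: "L2_tendsto M f g"
  shows "(\<lambda>n. \<integral>x. f n x \<bullet> h x \<partial>M) \<longlonglongrightarrow> (\<integral>x. g x \<bullet> h x \<partial>M)"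
proof (rule LIM_zero_cancel, rule Lim_null_comparison)
  have "(\<integral>x. f n x \<bullet> h x \<partial>M) - (\<integral>x. g x \<bullet> h x \<partial>M) = (\<integral>x. (f n x - g x) \<bullet> h x \<partial>M)" for n
    using integrable_inner[OF f h] integrable_inner[OF g h] by (simp add: inner_diff_left)
  then show "\<forall>\<^sub>F n in sequentially. norm ((\<integral>x. f n x \<bullet> h x \<partial>M) - (\<integral>x. g x \<bullet> h x \<partial>M))
      \<le> L2_norm M (\<lambda>x. f n x - g x) * L2_norm M h"
    using Cauchy_Schwarz_L2[OF square_integrable_diff[OF f g] h] by simp
  show "(\<lambda>n. L2_norm M (\<lambda>x. f n x - g x) * L2_norm M h) \<longlonglongrightarrow> 0"
    using tendsto_mult_left_zero[OF lim] .
qed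

lemma (in finite_measure) integral_norm_tendsto:
  assumes f: "\<And>n. square_integrable M (f n)" and g: "square_integrable M g"
    and lim: "L2_tendsto M f g"
  shows "(\<lambda>n. \<integral>x. norm (f n x) \<partial>M) \<longlonglongrightarrow> (\<integral>x. norm (g x) \<partial>M)"
proof (rule LIM_zero_cancel, rule Lim_null_comparison)
  note int = square_integrable_imp_integrable_norm
  have "norm ((\<integral>x. norm (f n x) \<partial>M) - (\<integral>x. norm (g x) \<partial>M))
      \<le> sqrt (measure M (space M)) * L2_norm M (\<lambda>x. f n x - g x)" for n
  proof -
    have "norm ((\<integral>x. norm (f n x) \<partial>M) - (\<integral>x. norm (g x) \<partial>M))
        = \<bar>\<integral>x. norm (f n x) - norm (g x) \<partial>M\<bar>"
      using int[OF f] int[OF g] by simp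
    also have "\<dots> \<le> (\<integral>x. \<bar>norm (f n x) - norm (g x)\<bar> \<partial>M)"
      by (rule integral_abs_bound)
    also have "\<dots> \<le> (\<integral>x. norm (f n x - g x) \<partial>M)"
      using int[OF f] int[OF g] int[OF square_integrable_diff[OF f g]]
      by (intro integral_mono) (auto simp: norm_triangle_ineq3)
    also have "\<dots> \<le> sqrt (measure M (space M)) * L2_norm M (\<lambda>x. f n x - g x)"
      by (intro integral_norm_le_L2_norm square_integrable_diff f g)
    finally show ?thesis .
  qed
  then show "\<forall>\<^sub>F n in sequentially. norm ((\<integral>x. norm (f n x) \<partial>M) - (\<integral>x. norm (g x) \<partial>M))
      \<le> sqrt (measure M (space M)) * L2_norm M (\<lambda>x. f n x - g x)"
    by simp
  show "(\<lambda>n. sqrt (measure M (space M)) * L2_norm M (\<lambda>x. f n x - g x)) \<longlonglongrightarrow> 0"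
    using tendsto_mult_right_zero[OF lim] .
qed

lemma nn_integral_L2_tendsto_0_iff:
  assumes f: "\<And>n. square_integrable M (f n)" and [measurable]: "g \<in> borel_measurable M"
  shows "(\<lambda>n. \<integral>\<^sup>+x. ennreal ((norm (g x - f n x))\<^sup>2) \<partial>M) \<longlonglongrightarrow> 0 \<longleftrightarrow>
    square_integrable M g \<and> L2_tendsto M f g"
proof -
  note [measurable] = f
  let ?I = "\<lambda>n. \<integral>\<^sup>+x. ennreal ((norm (g x - f n x))\<^sup>2) \<partial>M"
  have "?I \<longlonglongrightarrow> 0 \<longleftrightarrow> L2_tendsto M f g" if g: "square_integrable M g"
  proof -
    have "?I n = ennreal ((L2_norm M (\<lambda>x. f n x - g x))\<^sup>2)" for n
      using nn_integral_eq_L2_norm[OF square_integrable_diff[OF g f]]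
      by (simp add: L2_norm_minus_commute[of M g])
    then have "?I \<longlonglongrightarrow> 0 \<longleftrightarrow> (\<lambda>n. (L2_norm M (\<lambda>x. f n x - g x))\<^sup>2) \<longlonglongrightarrow> 0"
      by (simp add: tendsto_ennreal_iff[of _ _ 0, simplified])
    then show ?thesis
      using tendsto_real_sqrt[of "\<lambda>n. (L2_norm M (\<lambda>x. f n x - g x))\<^sup>2" 0 sequentially]
        tendsto_power[of "\<lambda>n. L2_norm M (\<lambda>x. f n x - g x)" 0 sequentially 2] by auto
  qed
  moreover have "square_integrable M g" if lim: "?I \<longlonglongrightarrow> 0"
  proof -
    have "\<forall>\<^sub>F n in sequentially. ?I n < 1"
      using lim by (rule order_tendstoD) simp
    then obtain n where "?I n < 1"
      using eventually_happens'[OF sequentially_bot] by blast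
    then have "?I n < \<infinity>" by (rule less_trans) simp
    then have "square_integrable M (\<lambda>x. g x - f n x)"
      by (simp add: square_integrable_iff_nn_integral)
    from square_integrable_add[OF this f[of n]] show ?thesis by simp
  qed
  ultimately show ?thesis by blast
qed

subsection \<open>Completeness\<close>

lemma convergent_fast_Cauchy:
  fixes a :: "nat \<Rightarrow> 'a::banach"
  assumes "(\<Sum>k. ennreal (4 ^ k * (norm (a (Suc k) - a k))\<^sup>2)) \<noteq> \<infinity>"
  shows "convergent a"
proof -
  have "summable (\<lambda>k. 4 ^ k * (norm (a (Suc k) - a k))\<^sup>2)"
    using assms by (intro summable_suminf_not_top) auto
  then have "\<forall>\<^sub>F k in sequentially. 4 ^ k * (norm (a (Suc k) - a k))\<^sup>2 < 1"
    by (intro order_tendstoD(2)[OF summable_LIMSEQ_zero]) auto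
  then have "\<forall>\<^sub>F k in sequentially. norm (a (Suc k) - a k) \<le> (1 / 2) ^ k"
  proof eventually_elim
    case (elim k)
    have "(2 ^ k * norm (a (Suc k) - a k))\<^sup>2 \<le> 1\<^sup>2"
      using elim
      by (simp add: power_mult_distrib power2_eq_square[of "2 ^ k"] power_mult_distrib[symmetric])
    then have "2 ^ k * norm (a (Suc k) - a k) \<le> 1"
      by (rule power2_le_imp_le) simp
    then show ?case by (simp add: field_simps power_one_over)
  qed
  then have "summable (\<lambda>k. a (Suc k) - a k)"
    by (rule summable_comparison_test_ev) (auto intro: summable_geometric)
  then have "convergent (\<lambda>n. (\<Sum>k<n. a (Suc k) - a k) + a 0)"
    by (intro convergent_add convergent_const) (simp add: summable_iff_convergent)
  then show ?thesis by (simp add: sum_lessThan_telescope)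
qed

lemma AE_convergent_fast_Cauchy_L2:
  fixes f :: "nat \<Rightarrow> 'a \<Rightarrow> 'b::{real_inner, banach, second_countable_topology}"
  assumes f: "\<And>n. square_integrable M (f n)"
    and fast: "\<And>k. L2_norm M (\<lambda>x. f (Suc k) x - f k x) \<le> (1 / 4) ^ k"
  shows "AE x in M. convergent (\<lambda>k. f k x)"
proof -
  note [measurable] = f
  let ?d = "\<lambda>k x. ennreal (4 ^ k * (norm (f (Suc k) x - f k x))\<^sup>2)"
  have d: "(\<integral>\<^sup>+x. ?d k x \<partial>M) \<le> ennreal ((1 / 4) ^ k)" for k
  proof -
    have "(\<integral>\<^sup>+x. ?d k x \<partial>M) = ennreal (4 ^ k) * ennreal ((L2_norm M (\<lambda>x. f (Suc k) x - f k x))\<^sup>2)"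
      by (simp add: ennreal_mult nn_integral_cmult nn_integral_eq_L2_norm square_integrable_diff f)
    also have "\<dots> \<le> ennreal (4 ^ k) * ennreal (((1 / 4) ^ k)\<^sup>2)"
      using fast[of k] by (intro mult_left_mono ennreal_leI power_mono) auto
    also have "\<dots> = ennreal ((1 / 4) ^ k)"
      by (simp add: ennreal_mult[symmetric] power2_eq_square power_mult_distrib[symmetric])
    finally show ?thesis .
  qed
  have "(\<integral>\<^sup>+x. (\<Sum>k. ?d k x) \<partial>M) = (\<Sum>k. \<integral>\<^sup>+x. ?d k x \<partial>M)"
    by (rule nn_integral_suminf) simp
  also have "\<dots> \<le> (\<Sum>k. ennreal ((1 / 4) ^ k))"
    by (intro suminf_le d) auto
  also have "\<dots> = ennreal (\<Sum>k. (1 / 4) ^ k)"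
    by (rule suminf_ennreal2) (auto intro: summable_geometric)
  finally have "(\<integral>\<^sup>+x. (\<Sum>k. ?d k x) \<partial>M) \<noteq> \<infinity>"
    by (auto simp: top_unique)
  then have "AE x in M. (\<Sum>k. ?d k x) \<noteq> \<infinity>"
    by (rule nn_integral_noteq_infinite[rotated]) measurable
  then show ?thesis
    by eventually_elim (rule convergent_fast_Cauchy)
qed

lemma L2_norm_Fatou:
  assumes f: "\<And>n. square_integrable M (f n)" and [measurable]: "g \<in> borel_measurable M"
    and lim: "AE x in M. (\<lambda>n. f n x) \<longlonglongrightarrow> g x"
    and bound: "\<forall>\<^sub>F n in sequentially. L2_norm M (f n) \<le> c"
  shows "square_integrable M g" "L2_norm M g \<le> c"
proof -
  note [measurable] = f
  obtain n where "L2_norm M (f n) \<le> c"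
    using eventually_happens'[OF sequentially_bot bound] by blast
  then have c: "0 \<le> c"
    by (rule order_trans[OF L2_norm_nonneg])
  have "(\<integral>\<^sup>+x. ennreal ((norm (g x))\<^sup>2) \<partial>M) = (\<integral>\<^sup>+x. liminf (\<lambda>n. ennreal ((norm (f n x))\<^sup>2)) \<partial>M)"
  proof (rule nn_integral_cong_AE, use lim in eventually_elim)
    fix x assume "(\<lambda>n. f n x) \<longlonglongrightarrow> g x"
    then have "(\<lambda>n. ennreal ((norm (f n x))\<^sup>2)) \<longlonglongrightarrow> ennreal ((norm (g x))\<^sup>2)"
      by (intro tendsto_intros)
    then show "ennreal ((norm (g x))\<^sup>2) = liminf (\<lambda>n. ennreal ((norm (f n x))\<^sup>2))"
      by (rule lim_imp_Liminf[OF sequentially_bot, symmetric])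
  qed
  also have "\<dots> \<le> liminf (\<lambda>n. \<integral>\<^sup>+x. ennreal ((norm (f n x))\<^sup>2) \<partial>M)"
    by (rule nn_integral_liminf) simp
  also have "\<dots> \<le> liminf (\<lambda>n. ennreal (c\<^sup>2))"
  proof (rule Liminf_mono)
    show "\<forall>\<^sub>F n in sequentially. (\<integral>\<^sup>+x. ennreal ((norm (f n x))\<^sup>2) \<partial>M) \<le> ennreal (c\<^sup>2)"
      using bound
      by eventually_elim (simp add: nn_integral_eq_L2_norm[OF f] ennreal_leI power_mono)
  qed
  finally have le: "(\<integral>\<^sup>+x. ennreal ((norm (g x))\<^sup>2) \<partial>M) \<le> ennreal (c\<^sup>2)"
    by (simp add: Liminf_const)
  then show "square_integrable M g"
    using le_less_trans[OF le ennreal_less_top] by (simp add: square_integrable_iff_nn_integral)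
  then have "(L2_norm M g)\<^sup>2 \<le> c\<^sup>2"
    using le by (simp add: nn_integral_eq_L2_norm ennreal_le_iff)
  then show "L2_norm M g \<le> c" using c by (rule power2_le_imp_le)
qed

theorem L2_complete:
  fixes f :: "nat \<Rightarrow> 'a \<Rightarrow> 'b::{real_inner, banach, second_countable_topology}"
  assumes f: "\<And>n. square_integrable M (f n)"
    and Cauchy: "L2_Cauchy M f"
  obtains g where "square_integrable M g" "L2_tendsto M f g"
proof -
  note [measurable] = f
  have "\<forall>k. \<exists>N. \<forall>m\<ge>N. \<forall>n\<ge>N. L2_norm M (\<lambda>x. f m x - f n x) \<le> (1 / 4) ^ k"
    using Cauchy by (simp add: L2_Cauchy_def)
  then obtain N where N: "\<And>k m n. N k \<le> m \<Longrightarrow> N k \<le> n \<Longrightarrow> L2_norm M (\<lambda>x. f m x - f n x) \<le> (1 / 4) ^ k"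
    by metis
  define r where "r k = (\<Sum>i\<le>k. N i)" for k
  have r: "N j \<le> r k" if "j \<le> k" for j k
    unfolding r_def using that by (intro member_le_sum) auto
  define g where "g x = lim (\<lambda>k. f (r k) x)" for x
  have g[measurable]: "g \<in> borel_measurable M"
    unfolding g_def by (intro borel_measurable_lim_metric) simp
  have "AE x in M. convergent (\<lambda>k. f (r k) x)"
    by (intro AE_convergent_fast_Cauchy_L2 f N r) auto
  then have lim: "AE x in M. (\<lambda>k. f (r k) x - f n x) \<longlonglongrightarrow> g x - f n x" for n
    by eventually_elim (auto simp: g_def convergent_LIMSEQ_iff intro: tendsto_diff)
  have bound: "\<forall>\<^sub>F k in sequentially. L2_norm M (\<lambda>x. f (r k) x - f n x) \<le> (1 / 4) ^ j"
    if "N j \<le> n" for j n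
    using eventually_ge_at_top[of j] by eventually_elim (intro N r that)
  have Fatou: "square_integrable M (\<lambda>x. g x - f n x)" "L2_norm M (\<lambda>x. g x - f n x) \<le> (1 / 4) ^ j"
    if "N j \<le> n" for j n
    using L2_norm_Fatou[OF square_integrable_diff[OF f f] _ lim bound[OF that]] by simp_all
  have "square_integrable M g"
    using square_integrable_add[OF Fatou(1)[of 0, OF order_refl] f[of "N 0"]] by simp
  moreover have "L2_tendsto M f g"
  proof (rule LIMSEQ_I)
    fix e :: real assume "0 < e"
    then obtain j where j: "(1 / 4) ^ j < e"
      using real_arch_pow_inv[of e "1 / 4"] by auto
    have "L2_norm M (\<lambda>x. f n x - g x) < e" if "N j \<le> n" for n
      using Fatou(2)[OF that] j by (simp add: L2_norm_minus_commute[of M "f n" g])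
    then show "\<exists>N. \<forall>n\<ge>N. norm (L2_norm M (\<lambda>x. f n x - g x) - 0) < e" by auto
  qed
  ultimately show ?thesis by (rule that)
qed

section \<open>Power means on a probability space\<close>

definition essentially_bounded :: "'a measure \<Rightarrow> ('a \<Rightarrow> real) \<Rightarrow> bool" where
  "essentially_bounded M f \<longleftrightarrow> f \<in> borel_measurable M \<and> (\<exists>K. AE x in M. \<bar>f x\<bar> \<le> K)"

lemma essentially_bounded_measurable [measurable_dest]:
  "essentially_bounded M f \<Longrightarrow> f \<in> borel_measurable M"
  by (simp add: essentially_bounded_def)

lemma essentially_boundedE:
  assumes "essentially_bounded M f"
  obtains K where "0 < K" "AE x in M. \<bar>f x\<bar> \<le> K"
proof -
  obtain K where "AE x in M. \<bar>f x\<bar> \<le> K"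
    using assms by (auto simp: essentially_bounded_def)
  then have "AE x in M. \<bar>f x\<bar> \<le> max 1 K" by eventually_elim simp
  then show ?thesis by (rule that[rotated]) simp
qed

definition power_mean :: "'a measure \<Rightarrow> ereal \<Rightarrow> ('a \<Rightarrow> real) \<Rightarrow> real" where
  "power_mean M p f =
    (if p = \<infinity> then real_of_ereal (esssup M (\<lambda>x. ereal \<bar>f x\<bar>))
     else (\<integral>x. \<bar>f x\<bar> powr real_of_ereal p \<partial>M) powr (1 / real_of_ereal p))"

lemma power_mean_ereal: "power_mean M (ereal p) f = (\<integral>x. \<bar>f x\<bar> powr p \<partial>M) powr (1 / p)"
  by (simp add: power_mean_def)

lemma power_mean_real_le_iff:
  assumes p: "0 < p" and c: "0 < c"
  shows "power_mean M (ereal p) f \<le> c \<longleftrightarrow> (\<integral>x. (\<bar>f x\<bar> / c) powr p \<partial>M) \<le> 1"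
proof -
  let ?I = "\<integral>x. \<bar>f x\<bar> powr p \<partial>M"
  have I: "0 \<le> ?I" by simp
  have "(\<integral>x. (\<bar>f x\<bar> / c) powr p \<partial>M) = ?I / c powr p"
    using c by (simp add: powr_divide)
  then have "(\<integral>x. (\<bar>f x\<bar> / c) powr p \<partial>M) \<le> 1 \<longleftrightarrow> ?I \<le> c powr p"
    using c by (simp add: divide_le_eq)
  also have "\<dots> \<longleftrightarrow> ?I powr (1 / p) \<le> (c powr p) powr (1 / p)"
    using p I powr_mono2[of "1 / p" ?I "c powr p"] powr_less_mono2[of "1 / p" "c powr p" ?I]
    by (auto simp: not_le[symmetric])
  also have "(c powr p) powr (1 / p) = c"
    using p c by (simp add: powr_powr)
  finally show ?thesis by (simp add: power_mean_ereal)
qed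

lemma powr_le_affine_powr:
  fixes t :: real
  assumes "0 \<le> t" "0 < q" "q \<le> p"
  shows "t powr q \<le> q / p * t powr p + (1 - q / p)"
proof (cases "t = 0")
  case False
  then show ?thesis
    using Youngs_inequality_0[of "q / p" "1 - q / p" "t powr p" 1] assms by (simp add: powr_powr)
qed (use assms in simp)

context prob_space
begin

lemma integrable_abs_powr:
  assumes f: "essentially_bounded M f" and p: "0 \<le> p"
  shows "integrable M (\<lambda>x. \<bar>f x\<bar> powr p)"
proof -
  note [measurable] = f
  obtain K where K: "0 < K" "AE x in M. \<bar>f x\<bar> \<le> K"
    using f by (rule essentially_boundedE)
  show ?thesis
  proof (rule integrable_const_bound)
    show "AE x in M. norm (\<bar>f x\<bar> powr p) \<le> K powr p"
      using K(2) by eventually_elim (use p in \<open>auto intro!: powr_mono2\<close>)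
  qed simp
qed

lemma power_mean_infinity_le_iff:
  assumes f: "essentially_bounded M f"
  shows "power_mean M \<infinity> f \<le> c \<longleftrightarrow> (AE x in M. \<bar>f x\<bar> \<le> c)"
proof -
  note [measurable] = f
  let ?E = "esssup M (\<lambda>x. ereal \<bar>f x\<bar>)"
  have le_iff: "?E \<le> ereal a \<longleftrightarrow> (AE x in M. \<bar>f x\<bar> \<le> a)" for a
  proof
    assume "?E \<le> ereal a"
    then show "AE x in M. \<bar>f x\<bar> \<le> a"
      using esssup_AE[where M = M and f = "\<lambda>x. ereal \<bar>f x\<bar>"]
      by (auto elim!: eventually_mono dest: order_trans)
  qed (auto intro: esssup_I)
  have "esssup M (\<lambda>x. 0) \<le> ?E"
    by (intro esssup_mono) auto
  then have "0 \<le> ?E"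
    by (simp add: esssup_const emeasure_space_1)
  moreover obtain K where "?E \<le> ereal K"
    using f essentially_boundedE le_iff by metis
  ultimately obtain r where "?E = ereal r"
    by (cases ?E) auto
  then show ?thesis
    using le_iff[of c] by (simp add: power_mean_def)
qed

lemma power_mean_nonneg:
  assumes "essentially_bounded M f"
  shows "0 \<le> power_mean M p f"
proof (cases "p = \<infinity>")
  case True
  have "AE x in M. \<bar>f x\<bar> \<le> power_mean M \<infinity> f"
    using power_mean_infinity_le_iff[OF assms] by blast
  then have "AE x in M. 0 \<le> power_mean M \<infinity> f"
    by eventually_elim linarith
  then show ?thesis using True by simp
qed (simp add: power_mean_def)

lemma power_mean_mono:
  assumes f: "essentially_bounded M f" and q: "0 < q" "q \<le> p"
  shows "power_mean M q f \<le> power_mean M p f"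
proof (rule dense_ge)
  fix c assume c: "power_mean M p f < c"
  then have c0: "0 < c" using power_mean_nonneg[OF f] by (rule le_less_trans[rotated])
  have int: "integrable M (\<lambda>x. (\<bar>f x\<bar> / c) powr r)" if "0 \<le> r" for r
    using integrable_abs_powr[OF f that] c0 by (simp add: powr_divide)
  consider (infinite) "q = \<infinity>" "p = \<infinity>"
    | (to_infinite) s where "q = ereal s" "p = \<infinity>" "0 < s"
    | (finite) s r where "q = ereal s" "p = ereal r" "0 < s" "s \<le> r"
    using q by (cases q; cases p) auto
  then show "power_mean M q f \<le> c"
  proof cases
    case infinite
    then show ?thesis using c by simp
  next
    case (to_infinite s)
    have "AE x in M. \<bar>f x\<bar> \<le> c"
      using c to_infinite power_mean_infinity_le_iff[OF f, of c] by simp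
    then have "AE x in M. (\<bar>f x\<bar> / c) powr s \<le> 1"
      by eventually_elim (use c0 to_infinite powr_mono2[of s _ 1] in simp)
    then have "(\<integral>x. (\<bar>f x\<bar> / c) powr s \<partial>M) \<le> 1"
      using int to_infinite by (intro integral_le_const) auto
    then show ?thesis using to_infinite c0 by (simp add: power_mean_real_le_iff)
  next
    case (finite s r)
    have "(\<integral>x. (\<bar>f x\<bar> / c) powr s \<partial>M)
        \<le> (\<integral>x. s / r * (\<bar>f x\<bar> / c) powr r + (1 - s / r) \<partial>M)"
      using int finite c0 by (intro integral_mono powr_le_affine_powr) auto
    also have "\<dots> = s / r * (\<integral>x. (\<bar>f x\<bar> / c) powr r \<partial>M) + (1 - s / r)"
      using int[of r] finite by (simp add: prob_space)
    also have "\<dots> \<le> s / r * 1 + (1 - s / r)"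
      using c c0 finite power_mean_real_le_iff[of r c M f]
      by (intro add_right_mono mult_left_mono) auto
    finally show ?thesis using finite c0 by (simp add: power_mean_real_le_iff)
  qed
qed

lemma power_mean_le:
  assumes "essentially_bounded M f" "AE x in M. \<bar>f x\<bar> \<le> c" "0 < p"
  shows "power_mean M p f \<le> c"
proof -
  have "power_mean M p f \<le> power_mean M \<infinity> f"
    using assms by (intro power_mean_mono) auto
  also have "\<dots> \<le> c"
    using assms by (simp add: power_mean_infinity_le_iff)
  finally show ?thesis .
qed

lemma expectation_powr_le:
  assumes f: "essentially_bounded M f" and K: "AE x in M. \<bar>f x\<bar> \<le> K" and q: "0 \<le> q" "q \<le> p"
  shows "expectation (\<lambda>x. \<bar>f x\<bar> powr p) \<le> K powr (p - q) * expectation (\<lambda>x. \<bar>f x\<bar> powr q)"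
proof -
  have "AE x in M. \<bar>f x\<bar> powr p \<le> K powr (p - q) * \<bar>f x\<bar> powr q"
    using K
  proof eventually_elim
    fix x assume "\<bar>f x\<bar> \<le> K"
    then have "\<bar>f x\<bar> powr (p - q) * \<bar>f x\<bar> powr q \<le> K powr (p - q) * \<bar>f x\<bar> powr q"
      using q by (intro mult_right_mono powr_mono2) auto
    then show "\<bar>f x\<bar> powr p \<le> K powr (p - q) * \<bar>f x\<bar> powr q"
      by (simp add: powr_add[symmetric])
  qed
  then have "expectation (\<lambda>x. \<bar>f x\<bar> powr p) \<le> expectation (\<lambda>x. K powr (p - q) * \<bar>f x\<bar> powr q)"
    using integrable_abs_powr[OF f] q by (intro integral_mono_AE) auto
  then show ?thesis by simp
qed

lemma power_mean_tendsto_at_left_real: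
  assumes f: "essentially_bounded M f" and p: "0 < p"
  shows "((\<lambda>q. power_mean M (ereal q) f) \<longlongrightarrow> power_mean M (ereal p) f) (at_left p)"
proof -
  let ?E = "\<lambda>q. expectation (\<lambda>x. \<bar>f x\<bar> powr q)"
  have near: "\<forall>\<^sub>F q in at_left p. 0 < q \<and> q < p"
    using p by (auto simp: eventually_at_left_field intro!: exI[of _ 0])
  have upper: "\<forall>\<^sub>F q in at_left p. power_mean M (ereal q) f \<le> power_mean M (ereal p) f"
    using near by eventually_elim (use power_mean_mono[OF f] in auto)
  show ?thesis
  proof (cases "power_mean M (ereal p) f = 0")
    case True
    then show ?thesis
      using tendsto_sandwich[OF _ upper tendsto_const[of 0]] power_mean_nonneg[OF f] by simp
  next
    case False
    obtain K where K: "0 < K" "AE x in M. \<bar>f x\<bar> \<le> K"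
      using f by (rule essentially_boundedE)
    show ?thesis
    proof (rule tendsto_sandwich[OF _ upper _ tendsto_const])
      show "\<forall>\<^sub>F q in at_left p. (?E p / K powr (p - q)) powr (1 / q) \<le> power_mean M (ereal q) f"
        using near
      proof eventually_elim
        case (elim q)
        then have "?E p / K powr (p - q) \<le> ?E q"
          using expectation_powr_le[OF f K(2), of q p] K(1) by (simp add: divide_le_eq mult.commute)
        then show ?case
          unfolding power_mean_ereal using elim by (intro powr_mono2) auto
      qed
      have "?E p \<noteq> 0" using False by (auto simp: power_mean_ereal)
      then have "((\<lambda>q. (?E p / K powr (p - q)) powr (1 / q))
          \<longlongrightarrow> (?E p / K powr (p - p)) powr (1 / p)) (at_left p)"
        using K(1) p by (intro tendsto_intros) auto
      then show "((\<lambda>q. (?E p / K powr (p - q)) powr (1 / q))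
          \<longlongrightarrow> power_mean M (ereal p) f) (at_left p)"
        using K(1) by (simp add: power_mean_ereal)
    qed
  qed
qed

lemma mult_prob_powr_le_power_mean:
  assumes f: "essentially_bounded M f" and b: "0 < b" and q: "0 < q"
  shows "b * prob {x\<in>space M. b \<le> \<bar>f x\<bar>} powr (1 / q) \<le> power_mean M (ereal q) f"
proof -
  note [measurable] = f
  have "{x\<in>space M. b \<le> \<bar>f x\<bar>} \<subseteq> {x\<in>space M. b powr q \<le> \<bar>f x\<bar> powr q}"
    using b q by (auto intro: powr_mono2)
  then have "prob {x\<in>space M. b \<le> \<bar>f x\<bar>} \<le> prob {x\<in>space M. b powr q \<le> \<bar>f x\<bar> powr q}"
    by (rule finite_measure_mono) measurable
  also have "\<dots> \<le> expectation (\<lambda>x. \<bar>f x\<bar> powr q) / b powr q"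
    using integrable_abs_powr[OF f] b q
    by (intro integral_Markov_inequality_measure[where A = "space M"]) auto
  finally have "b powr q * prob {x\<in>space M. b \<le> \<bar>f x\<bar>} \<le> expectation (\<lambda>x. \<bar>f x\<bar> powr q)"
    using b by (simp add: le_divide_eq mult.commute)
  then have "(b powr q * prob {x\<in>space M. b \<le> \<bar>f x\<bar>}) powr (1 / q) \<le> power_mean M (ereal q) f"
    unfolding power_mean_ereal using q by (intro powr_mono2) auto
  then show ?thesis using b q by (simp add: powr_mult powr_powr)
qed

lemma prob_superlevel_neq_0:
  assumes f: "essentially_bounded M f" and b: "b < power_mean M \<infinity> f"
  shows "prob {x\<in>space M. b \<le> \<bar>f x\<bar>} \<noteq> 0"
proof -
  note [measurable] = f
  have "\<not> (AE x in M. \<bar>f x\<bar> \<le> b)"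
    using b power_mean_infinity_le_iff[OF f, of b] by simp
  then have "\<not> (AE x in M. \<not> b \<le> \<bar>f x\<bar>)"
    by (rule contrapos_nn) (auto elim: eventually_mono)
  then show ?thesis by (simp add: prob_Collect_eq_0)
qed

lemma power_mean_tendsto_infinity:
  assumes f: "essentially_bounded M f"
  shows "((\<lambda>q. power_mean M (ereal q) f) \<longlongrightarrow> power_mean M \<infinity> f) at_top"
proof (rule order_tendstoI)
  have upper: "power_mean M (ereal q) f \<le> power_mean M \<infinity> f" if "0 < q" for q
    using power_mean_mono[OF f] that by simp
  show "\<forall>\<^sub>F q in at_top. power_mean M (ereal q) f < a" if "power_mean M \<infinity> f < a" for a
    using eventually_gt_at_top[of 0]
    by eventually_elim (use upper that in \<open>auto intro: le_less_trans\<close>)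
  fix a assume a: "a < power_mean M \<infinity> f"
  show "\<forall>\<^sub>F q in at_top. a < power_mean M (ereal q) f"
  proof (cases "a < 0")
    case True
    then show ?thesis
      using less_le_trans[OF True power_mean_nonneg[OF f]] by simp
  next
    case False
    obtain b where b: "a < b" "b < power_mean M \<infinity> f" using dense[OF a] by blast
    let ?\<delta> = "prob {x\<in>space M. b \<le> \<bar>f x\<bar>}"
    have \<delta>: "?\<delta> \<noteq> 0"
      using f b(2) by (rule prob_superlevel_neq_0)
    have "((\<lambda>q::real. b * ?\<delta> powr (1 / q)) \<longlongrightarrow> b * ?\<delta> powr 0) at_top"
      using \<delta>
      by (intro tendsto_intros tendsto_divide_0[OF tendsto_const] filterlim_ident
          filterlim_at_top_imp_at_infinity) auto
    then have "\<forall>\<^sub>F q in at_top. a < b * ?\<delta> powr (1 / q)"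
      using b(1) \<delta> by (intro order_tendstoD(1)) auto
    then show ?thesis
      using eventually_gt_at_top[of 0]
    proof eventually_elim
      case (elim q)
      then show ?case
        using mult_prob_powr_le_power_mean[OF f, of b q] b(1) False by simp
    qed
  qed
qed

lemma power_mean_tendsto_at_left:
  assumes f: "essentially_bounded M f" and p: "0 < p"
  shows "((\<lambda>q. power_mean M q f) \<longlongrightarrow> power_mean M p f) (at_left p)"
proof (cases p)
  case (real r)
  then show ?thesis
    using power_mean_tendsto_at_left_real[OF f, of r] p
    by (simp add: at_left_ereal filterlim_filtermap)
next
  case PInf
  then show ?thesis
    using power_mean_tendsto_infinity[OF f] by (simp add: at_left_PInf filterlim_filtermap)
qed (use p in auto)

end

section \<open>Smooth functions and test functions\<close>

lemma smooth_funD: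
  assumes "smooth_fun f"
  shows "f differentiable_on UNIV" "continuous_on UNIV f"
    "b \<in> Basis \<Longrightarrow> smooth_fun (\<lambda>x. frechet_derivative f (at x) b)"
  using assms by (auto elim: smooth_fun.cases)

lemma smooth_fun_const: "smooth_fun (\<lambda>x::'a::euclidean_space. c)"
proof -
  have "\<exists>c. f = (\<lambda>x::'a. c) \<Longrightarrow> smooth_fun f" for f
  proof (coinduction arbitrary: f rule: smooth_fun.coinduct)
    case smooth_fun
    then obtain c where f: "f = (\<lambda>x. c)" by blast
    have "frechet_derivative f (at x) b = 0" for x b
      using frechet_derivative_at[of f "\<lambda>_. 0" x] by (simp add: f)
    then show ?case using f by (auto simp: differentiable_on_def)
  qed
  then show ?thesis by blast
qed

lemma has_derivative_powr_const:
  fixes f :: "'a::real_normed_vector \<Rightarrow> real"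
  assumes "(f has_derivative f') (at x)" "0 < f x"
  shows "((\<lambda>x. f x powr a) has_derivative (\<lambda>h. (a * f x powr (a - 1)) * f' h)) (at x)"
proof -
  have "((\<lambda>t. t powr a) has_real_derivative a * f x powr (a - 1)) (at (f x))"
    using assms(2) by (rule has_real_derivative_powr)
  from DERIV_compose_FDERIV[OF this assms(1)] show ?thesis
    by (simp add: mult.commute)
qed

text \<open>Coinduction up to algebraic operations: the closure is stable under partial derivatives.\<close>
inductive smooth_closure :: "('a::euclidean_space \<Rightarrow> real) \<Rightarrow> bool" where
  base: "smooth_fun f \<Longrightarrow> smooth_closure f"
| add: "smooth_closure f \<Longrightarrow> smooth_closure g \<Longrightarrow> smooth_closure (\<lambda>x. f x + g x)"
| mult: "smooth_closure f \<Longrightarrow> smooth_closure g \<Longrightarrow> smooth_closure (\<lambda>x. f x * g x)"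
| powr: "smooth_closure f \<Longrightarrow> (\<And>x. f x > 0) \<Longrightarrow> smooth_closure (\<lambda>x. f x powr a)"

lemma smooth_closure_derivative:
  fixes f :: "'a::euclidean_space \<Rightarrow> real"
  assumes "smooth_closure f"
  shows "(\<forall>x. f differentiable (at x)) \<and>
    (\<forall>b\<in>Basis. smooth_closure (\<lambda>x. frechet_derivative f (at x) b))"
  using assms
proof induction
  case (base f)
  then show ?case
    using smooth_funD[OF base] by (auto simp: differentiable_on_def intro: smooth_closure.base)
next
  case (add f g)
  have deriv: "((\<lambda>x. f x + g x) has_derivative
      (\<lambda>h. frechet_derivative f (at x) h + frechet_derivative g (at x) h)) (at x)" for x
    using add.IH by (intro derivative_intros) (auto simp: frechet_derivative_works)
  show ?case
    using add.IH deriv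
    by (auto simp: frechet_derivative_at[OF deriv, symmetric] differentiable_def
        intro!: smooth_closure.add)
next
  case (mult f g)
  have deriv: "((\<lambda>x. f x * g x) has_derivative
      (\<lambda>h. f x * frechet_derivative g (at x) h + frechet_derivative f (at x) h * g x)) (at x)" for x
    using mult.IH by (intro derivative_intros) (auto simp: frechet_derivative_works)
  show ?case
    using mult deriv
    by (auto simp: frechet_derivative_at[OF deriv, symmetric] differentiable_def
        intro!: smooth_closure.add smooth_closure.mult)
next
  case (powr f a)
  have deriv: "((\<lambda>x. f x powr a) has_derivative
      (\<lambda>h. (a * f x powr (a - 1)) * frechet_derivative f (at x) h)) (at x)" for x
    using powr by (intro has_derivative_powr_const) (auto simp: frechet_derivative_works)
  have "smooth_closure (\<lambda>x. (a * f x powr (a - 1)) * frechet_derivative f (at x) b)"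
    if "b \<in> Basis" for b
    using powr that
    by (intro smooth_closure.mult smooth_closure.powr smooth_closure.base[OF smooth_fun_const]) auto
  then show ?case
    using deriv by (auto simp: frechet_derivative_at[OF deriv, symmetric] differentiable_def)
qed

lemma smooth_fun_eq_closure: "smooth_fun f \<longleftrightarrow> smooth_closure f"
proof
  show "smooth_closure f \<Longrightarrow> smooth_fun f"
  proof (coinduction arbitrary: f rule: smooth_fun.coinduct)
    case smooth_fun
    then have "\<forall>x. f differentiable (at x)"
      "\<forall>b\<in>Basis. smooth_closure (\<lambda>x. frechet_derivative f (at x) b)"
      using smooth_closure_derivative by blast+
    then show ?case
      by (auto simp: differentiable_on_def continuous_on_eq_continuous_at
          intro: differentiable_imp_continuous_within)
  qed
qed (rule smooth_closure.base)

lemma smooth_fun_add: "smooth_fun f \<Longrightarrow> smooth_fun g \<Longrightarrow> smooth_fun (\<lambda>x. f x + g x)"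
  and smooth_fun_mult: "smooth_fun f \<Longrightarrow> smooth_fun g \<Longrightarrow> smooth_fun (\<lambda>x. f x * g x)"
  and smooth_fun_powr: "smooth_fun f \<Longrightarrow> (\<And>x. f x > 0) \<Longrightarrow> smooth_fun (\<lambda>x. f x powr a)"
  by (simp_all add: smooth_fun_eq_closure smooth_closure.intros)

lemma smooth_fun_has_derivative_grad:
  fixes f :: "'a::euclidean_space \<Rightarrow> real"
  assumes "smooth_fun f"
  shows "(f has_derivative (\<lambda>h. grad f x \<bullet> h)) (at x)"
proof -
  have deriv: "(f has_derivative frechet_derivative f (at x)) (at x)"
    using smooth_funD(1)[OF assms] by (auto simp: frechet_derivative_works differentiable_on_def)
  then have lin: "linear (frechet_derivative f (at x))"
    using has_derivative_linear by blast
  have "frechet_derivative f (at x) h = grad f x \<bullet> h" for h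
  proof -
    have "frechet_derivative f (at x) h = frechet_derivative f (at x) (\<Sum>b\<in>Basis. (h \<bullet> b) *\<^sub>R b)"
      by (simp add: euclidean_representation)
    also have "\<dots> = (\<Sum>b\<in>Basis. (h \<bullet> b) * frechet_derivative f (at x) b)"
      by (simp add: linear_sum[OF lin] linear_scale[OF lin])
    also have "\<dots> = grad f x \<bullet> h"
      by (simp add: grad_def inner_sum_left inner_commute[of h] mult.commute)
    finally show ?thesis .
  qed
  then show ?thesis using deriv by (metis (no_types, lifting) ext)
qed

lemma grad_eqI:
  fixes f :: "'a::euclidean_space \<Rightarrow> real"
  assumes "(f has_derivative (\<lambda>h. v \<bullet> h)) (at x)"
  shows "grad f x = v"
  by (simp add: grad_def frechet_derivative_at[OF assms, symmetric] euclidean_representation)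

lemma smooth_fun_continuous_grad:
  assumes "smooth_fun f"
  shows "continuous_on UNIV (grad f)"
  unfolding grad_def using smooth_funD(2)[OF smooth_funD(3)[OF assms]]
  by (intro continuous_intros) auto

lemma test_funD:
  assumes "test_fun \<Omega> f"
  shows "smooth_fun f" "continuous_on UNIV f" "continuous_on UNIV (grad f)"
    "x \<notin> \<Omega> \<Longrightarrow> f x = 0" "x \<notin> \<Omega> \<Longrightarrow> grad f x = 0"
proof -
  show s: "smooth_fun f" and "continuous_on UNIV f" "continuous_on UNIV (grad f)"
    using assms smooth_funD(2) smooth_fun_continuous_grad by (auto simp: test_fun_def)
  have sub: "closure {x. f x \<noteq> 0} \<subseteq> \<Omega>"
    using assms by (auto simp: test_fun_def)
  show "f x = 0" if "x \<notin> \<Omega>"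
    using that sub closure_subset[of "{x. f x \<noteq> 0}"] by auto
  show "grad f x = 0" if "x \<notin> \<Omega>"
  proof (rule grad_eqI)
    have x: "x \<in> - closure {x. f x \<noteq> 0}" using that sub by auto
    have "((\<lambda>x. 0) has_derivative (\<lambda>h. 0)) (at x)" by simp
    then have "(f has_derivative (\<lambda>h. 0)) (at x)"
    proof (rule has_derivative_transform_within_open[OF _ _ x])
      show "0 = f y" if "y \<in> - closure {x. f x \<noteq> 0}" for y
        using that closure_subset[of "{x. f x \<noteq> 0}"] by auto
    qed auto
    then show "(f has_derivative (\<lambda>h. 0 \<bullet> h)) (at x)" by simp
  qed
qed

lemma test_fun_bounded:
  fixes f :: "'a::euclidean_space \<Rightarrow> real"
  assumes "test_fun \<Omega> f"
  obtains B where "\<And>x. norm (f x) \<le> B" "\<And>x. norm (grad f x) \<le> B"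
proof -
  let ?K = "closure {x. f x \<noteq> 0}"
  have K: "compact ?K" and t: "test_fun ?K f" using assms by (auto simp: test_fun_def)
  have "bounded (f ` ?K)" "bounded (grad f ` ?K)"
    using test_funD(2,3)[OF assms] K
    by (meson compact_continuous_image compact_imp_bounded continuous_on_subset subset_UNIV)+
  then obtain B1 B2 where "\<forall>x\<in>?K. norm (f x) \<le> B1" "\<forall>x\<in>?K. norm (grad f x) \<le> B2"
    by (auto simp: bounded_iff)
  then have "norm (f x) \<le> max 0 (max B1 B2)" "norm (grad f x) \<le> max 0 (max B1 B2)" for x
    using test_funD(4,5)[OF t, of x] by (cases "x \<in> ?K"; force simp: max_def)+
  then show ?thesis using that by blast
qed

lemma test_fun_subset_support:
  fixes f :: "'a::euclidean_space \<Rightarrow> real"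
  assumes "test_fun \<Omega> f" "smooth_fun g" "\<And>x. f x = 0 \<Longrightarrow> g x = 0"
  shows "test_fun \<Omega> g"
proof -
  have "closure {x. g x \<noteq> 0} \<subseteq> closure {x. f x \<noteq> 0}"
    using assms(3) by (intro closure_mono) auto
  then show ?thesis
    using assms(1,2) unfolding test_fun_def compact_eq_bounded_closed
    by (auto intro: bounded_subset)
qed

lemma test_fun_zero: "test_fun \<Omega> (\<lambda>x. 0)"
  by (simp add: test_fun_def smooth_fun_const)

lemma smooth_fun_borel_measurable:
  assumes "smooth_fun f"
  shows "f \<in> borel_measurable borel" "grad f \<in> borel_measurable borel"
  using smooth_funD(2)[OF assms] smooth_fun_continuous_grad[OF assms]
  by (auto intro: borel_measurable_continuous_onI)

lemma grad_add_scale: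
  assumes "smooth_fun f" "smooth_fun g"
  shows "grad (\<lambda>x. f x + c * g x) x = grad f x + c *\<^sub>R grad g x"
  by (rule grad_eqI)
    (auto simp: inner_add_left intro!: derivative_eq_intros smooth_fun_has_derivative_grad assms)

lemma test_fun_add_scale:
  assumes f: "test_fun \<Omega> f" and g: "test_fun \<Omega> g"
  shows "test_fun \<Omega> (\<lambda>x. f x + c * g x)"
proof -
  have "closure {x. f x + c * g x \<noteq> 0} \<subseteq> closure ({x. f x \<noteq> 0} \<union> {x. g x \<noteq> 0})"
    by (intro closure_mono) auto
  then have sub: "closure {x. f x + c * g x \<noteq> 0} \<subseteq> closure {x. f x \<noteq> 0} \<union> closure {x. g x \<noteq> 0}"
    by (simp add: closure_Un)
  have "compact (closure {x. f x \<noteq> 0} \<union> closure {x. g x \<noteq> 0})"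
    using f g by (auto simp: test_fun_def)
  then have "compact (closure {x. f x + c * g x \<noteq> 0})"
    using sub unfolding compact_eq_bounded_closed by (meson bounded_subset closed_closure)
  moreover have "smooth_fun (\<lambda>x. f x + c * g x)"
    using f g by (intro smooth_fun_add smooth_fun_mult smooth_fun_const) (auto simp: test_fun_def)
  ultimately show ?thesis
    using sub f g by (auto simp: test_fun_def)
qed

lemma grad_diff:
  "smooth_fun f \<Longrightarrow> smooth_fun g \<Longrightarrow> grad (\<lambda>x. f x - g x) x = grad f x - grad g x"
  using grad_add_scale[of f g "- 1" x] by simp

lemma test_fun_diff:
  "test_fun \<Omega> f \<Longrightarrow> test_fun \<Omega> g \<Longrightarrow> test_fun \<Omega> (\<lambda>x. f x - g x)"
  using test_fun_add_scale[of \<Omega> f g "- 1"] by simp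

lemma test_fun_uminus:
  assumes "test_fun \<Omega> f"
  shows "test_fun \<Omega> (\<lambda>x. - f x)" "grad (\<lambda>x. - f x) x = - grad f x"
  using test_fun_add_scale[OF assms assms, of "- 2"] test_funD(1)[OF assms]
    grad_add_scale[of f f "- 2" x]
  by (simp_all add: scaleR_2)

subsection \<open>Smooth truncation\<close>

definition smooth_pos_part :: "real \<Rightarrow> real \<Rightarrow> real" where
  "smooth_pos_part e t = (sqrt (t\<^sup>2 + e\<^sup>2) + t) / 2"

lemma smooth_pos_part_approx:
  assumes "0 \<le> e"
  shows "max 0 t \<le> smooth_pos_part e t" "smooth_pos_part e t \<le> max 0 t + e / 2"
proof -
  have "\<bar>t\<bar> \<le> sqrt (t\<^sup>2 + e\<^sup>2)" "sqrt (t\<^sup>2 + e\<^sup>2) \<le> \<bar>t\<bar> + e"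
    using assms sqrt_sum_squares_le_sum_abs[of t e] real_sqrt_le_mono[of "t\<^sup>2" "t\<^sup>2 + e\<^sup>2"] by auto
  then show "max 0 t \<le> smooth_pos_part e t" "smooth_pos_part e t \<le> max 0 t + e / 2"
    unfolding smooth_pos_part_def by (simp_all add: max_def abs_if split: if_splits)
qed

lemma smooth_pos_part_has_derivative:
  assumes "0 < e"
  obtains s where "0 \<le> s" "s \<le> 1" "(smooth_pos_part e has_real_derivative s) (at t)"
proof -
  define r where "r = sqrt (t\<^sup>2 + e\<^sup>2)"
  have pos: "t\<^sup>2 + e\<^sup>2 > 0" using assms by (simp add: add_nonneg_pos)
  then have r: "0 < r" "\<bar>t\<bar> \<le> r"
    using real_sqrt_le_mono[of "t\<^sup>2" "t\<^sup>2 + e\<^sup>2"] by (auto simp: r_def)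
  have "(smooth_pos_part e has_real_derivative ((2 * t) * (inverse r / 2) + 1) / 2) (at t)"
    unfolding smooth_pos_part_def[abs_def] r_def using pos by (auto intro!: derivative_eq_intros)
  moreover have "((2 * t) * (inverse r / 2) + 1) / 2 = (t / r + 1) / 2"
    using r(1) by (simp add: divide_simps)
  ultimately have "(smooth_pos_part e has_real_derivative (t / r + 1) / 2) (at t)"
    by (simp only:)
  moreover have "- 1 \<le> t / r" "t / r \<le> 1"
    using r by (simp_all add: pos_le_divide_eq abs_le_iff)
  then have "0 \<le> (t / r + 1) / 2" "(t / r + 1) / 2 \<le> 1"
    by simp_all
  ultimately show ?thesis using that by blast
qed

lemma smooth_fun_smooth_pos_part:
  assumes "smooth_fun f" "0 < e"
  shows "smooth_fun (\<lambda>x. smooth_pos_part e (f x))"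
proof -
  have pos: "0 < f x * f x + e\<^sup>2" for x
    using assms(2) by (simp add: add_nonneg_pos)
  have "smooth_fun (\<lambda>x. (1 / 2) * ((f x * f x + e\<^sup>2) powr (1 / 2) + f x))"
    using pos assms(1)
    by (intro smooth_fun_powr smooth_fun_add smooth_fun_mult smooth_fun_const)
  also have "(\<lambda>x. (1 / 2) * ((f x * f x + e\<^sup>2) powr (1 / 2) + f x)) = (\<lambda>x. smooth_pos_part e (f x))"
    using pos[THEN less_imp_le] by (simp add: smooth_pos_part_def powr_half_sqrt power2_eq_square)
  finally show ?thesis .
qed

text \<open>Shifted to vanish at 0, so that truncating a function does not enlarge its support.\<close>
definition smooth_truncation :: "real \<Rightarrow> real \<Rightarrow> real \<Rightarrow> real" where
  "smooth_truncation k e t = smooth_pos_part e (t - k) - smooth_pos_part e (- k)"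

lemma smooth_truncation_approx:
  assumes "0 \<le> k" "0 \<le> e"
  shows "\<bar>smooth_truncation k e t - max 0 (t - k)\<bar> \<le> e"
proof -
  have "max 0 (- k) = 0" using assms(1) by simp
  then show ?thesis
    using smooth_pos_part_approx[OF assms(2), of "t - k"]
      smooth_pos_part_approx[OF assms(2), of "- k"]
    unfolding smooth_truncation_def by linarith
qed

lemma test_fun_smooth_truncation:
  assumes f: "test_fun \<Omega> f" and e: "0 < e"
  shows "test_fun \<Omega> (\<lambda>x. smooth_truncation k e (f x))"
proof (rule test_fun_subset_support[OF f])
  have "smooth_fun (\<lambda>x. smooth_pos_part e (f x + - k) + - smooth_pos_part e (- k))"
    using test_funD(1)[OF f] e
    by (intro smooth_fun_add smooth_fun_smooth_pos_part smooth_fun_const)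
  then show "smooth_fun (\<lambda>x. smooth_truncation k e (f x))"
    by (simp add: smooth_truncation_def)
qed (simp add: smooth_truncation_def)

lemma grad_smooth_truncation:
  assumes f: "smooth_fun f" and e: "0 < e"
  obtains s where "0 \<le> s" "s \<le> 1" "grad (\<lambda>x. smooth_truncation k e (f x)) x = s *\<^sub>R grad f x"
proof -
  obtain s where s: "0 \<le> s" "s \<le> 1"
    and deriv: "(smooth_pos_part e has_real_derivative s) (at (f x - k))"
    using smooth_pos_part_has_derivative[OF e] by blast
  have "((\<lambda>t. smooth_pos_part e (t - k)) has_real_derivative s * 1) (at (f x))"
    by (rule DERIV_chain2[where g = "\<lambda>t. t - k", OF deriv]) (auto intro!: derivative_eq_intros)
  then have "(smooth_truncation k e has_real_derivative s) (at (f x))"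
    unfolding smooth_truncation_def[abs_def] by (auto intro!: derivative_eq_intros)
  then have "((\<lambda>x. smooth_truncation k e (f x)) has_derivative (\<lambda>h. (grad f x \<bullet> h) * s)) (at x)"
    by (rule DERIV_compose_FDERIV) (rule smooth_fun_has_derivative_grad[OF f])
  then have "grad (\<lambda>x. smooth_truncation k e (f x)) x = s *\<^sub>R grad f x"
    by (intro grad_eqI) (simp add: mult.commute)
  then show ?thesis using s that by blast
qed

section \<open>A Nash type inequality\<close>

lemma nn_integral_lborel_translate:
  fixes g :: "'a::euclidean_space \<Rightarrow> ennreal"
  assumes [measurable]: "g \<in> borel_measurable borel"
  shows "(\<integral>\<^sup>+x. g (x + h) \<partial>lborel) = (\<integral>\<^sup>+x. g x \<partial>lborel)"
proof -
  have "(\<integral>\<^sup>+x. g x \<partial>lborel) = (\<integral>\<^sup>+x. g x \<partial>distr lborel borel ((+) h))"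
    by (simp add: lborel_distr_plus)
  also have "\<dots> = (\<integral>\<^sup>+x. g (x + h) \<partial>lborel)"
    by (subst nn_integral_distr) (auto simp: add.commute)
  finally show ?thesis by simp
qed

text \<open>Integrate \<open>2 c g - c\<^sup>2 \<le> g\<^sup>2\<close> with \<open>c = F 1 - F 0\<close>.\<close>
lemma increment_square_le:
  fixes F g :: "real \<Rightarrow> real"
  assumes F: "\<And>t. (F has_real_derivative g t) (at t)" and g: "continuous_on UNIV g"
  shows "ennreal ((F 1 - F 0)\<^sup>2) \<le> (\<integral>\<^sup>+t. ennreal ((g t)\<^sup>2) * indicator {0..1} t \<partial>lborel)"
proof -
  have gc: "isCont g t" for t using g by (simp add: continuous_on_eq_continuous_at)
  define c where "c = F 1 - F 0"
  have FTC: "has_bochner_integral lborel (\<lambda>t. (2 * c * g t - c\<^sup>2) * indicator {0..1} t)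
      ((2 * c * F 1 - c\<^sup>2 * 1) - (2 * c * F 0 - c\<^sup>2 * 0))"
    using F gc by (intro has_bochner_integral_FTC_Icc_real continuous_intros)
      (auto intro!: derivative_eq_intros)
  have int: "integrable lborel (\<lambda>t. (g t)\<^sup>2 * indicator {0..1} t)"
    using gc by (intro borel_integrable_atLeastAtMost) (auto intro!: continuous_intros)
  have "c\<^sup>2 = (\<integral>t. (2 * c * g t - c\<^sup>2) * indicator {0..1} t \<partial>lborel)"
    using has_bochner_integral_integral_eq[OF FTC]
    by (simp add: c_def power2_eq_square algebra_simps)
  also have "\<dots> \<le> (\<integral>t. (g t)\<^sup>2 * indicator {0..1} t \<partial>lborel)"
  proof (rule integral_mono)
    show "(2 * c * g t - c\<^sup>2) * indicator {0..1} t \<le> (g t)\<^sup>2 * indicator {0..1} t" for t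
      using zero_le_power2[of "g t - c"]
      by (intro mult_right_mono) (auto simp: power2_diff algebra_simps)
  qed (use FTC int in \<open>auto simp: has_bochner_integral_iff\<close>)
  finally have "ennreal (c\<^sup>2) \<le> ennreal (\<integral>t. (g t)\<^sup>2 * indicator {0..1} t \<partial>lborel)"
    by (rule ennreal_leI)
  also have "\<dots> = (\<integral>\<^sup>+t. ennreal ((g t)\<^sup>2 * indicator {0..1} t) \<partial>lborel)"
    using int by (subst nn_integral_eq_integral) auto
  also have "\<dots> = (\<integral>\<^sup>+t. ennreal ((g t)\<^sup>2) * indicator {0..1} t \<partial>lborel)"
    by (intro nn_integral_cong) (auto split: split_indicator)
  finally show ?thesis by (simp add: c_def)
qed

lemma increment_square_le_segment_integral:
  fixes f :: "'a::euclidean_space \<Rightarrow> real"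
  assumes f: "smooth_fun f"
  shows "ennreal ((f (x + h) - f x)\<^sup>2)
    \<le> (\<integral>\<^sup>+t. ennreal ((norm h)\<^sup>2 * (norm (grad f (x + t *\<^sub>R h)))\<^sup>2) * indicator {0..1} t \<partial>lborel)"
proof -
  have "((\<lambda>t. f (x + t *\<^sub>R h)) has_derivative (\<lambda>s. grad f (x + t *\<^sub>R h) \<bullet> (s *\<^sub>R h))) (at t)" for t
    by (rule has_derivative_compose[OF _ smooth_fun_has_derivative_grad[OF f]])
      (auto intro!: derivative_eq_intros)
  then have "((\<lambda>t. f (x + t *\<^sub>R h)) has_real_derivative grad f (x + t *\<^sub>R h) \<bullet> h) (at t)" for t
    by (simp add: has_field_derivative_def mult_commute_abs)
  moreover have "continuous_on UNIV (\<lambda>t. grad f (x + t *\<^sub>R h) \<bullet> h)"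
    by (intro continuous_intros continuous_on_compose2[OF smooth_fun_continuous_grad[OF f]]) auto
  ultimately have "ennreal ((f (x + h) - f x)\<^sup>2)
      \<le> (\<integral>\<^sup>+t. ennreal ((grad f (x + t *\<^sub>R h) \<bullet> h)\<^sup>2) * indicator {0..1} t \<partial>lborel)"
    using increment_square_le[of "\<lambda>t. f (x + t *\<^sub>R h)" "\<lambda>t. grad f (x + t *\<^sub>R h) \<bullet> h"] by simp
  also have "(grad f y \<bullet> h)\<^sup>2 \<le> (norm h)\<^sup>2 * (norm (grad f y))\<^sup>2" for y
    using Cauchy_Schwarz_ineq[of "grad f y" h] by (simp add: power2_norm_eq_inner mult.commute)
  then have "(\<integral>\<^sup>+t. ennreal ((grad f (x + t *\<^sub>R h) \<bullet> h)\<^sup>2) * indicator {0..1} t \<partial>lborel)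
      \<le> (\<integral>\<^sup>+t. ennreal ((norm h)\<^sup>2 * (norm (grad f (x + t *\<^sub>R h)))\<^sup>2) * indicator {0..1} t \<partial>lborel)"
    by (intro nn_integral_mono mult_right_mono ennreal_leI) auto
  finally show ?thesis .
qed

lemma nn_integral_translation_diff_square_le:
  fixes f :: "'a::euclidean_space \<Rightarrow> real"
  assumes f: "smooth_fun f"
  shows "(\<integral>\<^sup>+x. ennreal ((f (x + h) - f x)\<^sup>2) \<partial>lborel)
    \<le> ennreal ((norm h)\<^sup>2) * (\<integral>\<^sup>+x. ennreal ((norm (grad f x))\<^sup>2) \<partial>lborel)"
proof -
  note [measurable] = smooth_fun_borel_measurable[OF f]
  let ?D = "\<lambda>x. ennreal ((norm h)\<^sup>2 * (norm (grad f x))\<^sup>2)"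
  have "(\<integral>\<^sup>+x. ennreal ((f (x + h) - f x)\<^sup>2) \<partial>lborel)
      \<le> (\<integral>\<^sup>+x. \<integral>\<^sup>+t. ?D (x + t *\<^sub>R h) * indicator {0..1} t \<partial>lborel \<partial>lborel)"
    by (intro nn_integral_mono increment_square_le_segment_integral f)
  also have "\<dots> = (\<integral>\<^sup>+t. \<integral>\<^sup>+x. ?D (x + t *\<^sub>R h) * indicator {0..1} t \<partial>lborel \<partial>lborel)"
    by (rule lborel_pair.Fubini') measurable
  also have "\<dots> = (\<integral>\<^sup>+t. (\<integral>\<^sup>+x. ?D x \<partial>lborel) * indicator {0..1} (t::real) \<partial>lborel)"
    by (simp add: nn_integral_multc nn_integral_lborel_translate[where g = ?D])
  also have "\<dots> = (\<integral>\<^sup>+x. ?D x \<partial>lborel)"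
    by (subst nn_integral_cmult_indicator) auto
  finally show ?thesis
    by (simp add: ennreal_mult nn_integral_cmult)
qed

lemma nn_integral_autocorrelation:
  fixes g :: "'a::euclidean_space \<Rightarrow> ennreal"
  assumes [measurable]: "g \<in> borel_measurable borel"
  shows "(\<integral>\<^sup>+h. \<integral>\<^sup>+x. g x * g (x + h) \<partial>lborel \<partial>lborel) = (\<integral>\<^sup>+x. g x \<partial>lborel)\<^sup>2"
proof -
  have "(\<integral>\<^sup>+h. \<integral>\<^sup>+x. g x * g (x + h) \<partial>lborel \<partial>lborel)
      = (\<integral>\<^sup>+x. \<integral>\<^sup>+h. g x * g (h + x) \<partial>lborel \<partial>lborel)"
    by (subst lborel_pair.Fubini') (auto simp: add.commute)
  also have "\<dots> = (\<integral>\<^sup>+x. g x \<partial>lborel)\<^sup>2"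
    by (simp add: nn_integral_cmult nn_integral_multc nn_integral_lborel_translate power2_eq_square)
  finally show ?thesis .
qed

text \<open>Integrate \<open>f(x+h)\<^sup>2 + f(x)\<^sup>2 \<le> (f(x+h) - f(x))\<^sup>2 + 2 \<bar>f(x) f(x+h)\<bar>\<close> over all \<open>x\<close>.\<close>
lemma nn_integral_square_le_autocorrelation:
  fixes f :: "'a::euclidean_space \<Rightarrow> real"
  assumes f: "smooth_fun f"
  shows "2 * (\<integral>\<^sup>+x. ennreal ((f x)\<^sup>2) \<partial>lborel)
    \<le> ennreal ((norm h)\<^sup>2) * (\<integral>\<^sup>+x. ennreal ((norm (grad f x))\<^sup>2) \<partial>lborel)
      + 2 * (\<integral>\<^sup>+x. ennreal \<bar>f x\<bar> * ennreal \<bar>f (x + h)\<bar> \<partial>lborel)"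
proof -
  note [measurable] = smooth_fun_borel_measurable[OF f]
  have "ennreal ((f (x + h))\<^sup>2) + ennreal ((f x)\<^sup>2)
      \<le> ennreal ((f (x + h) - f x)\<^sup>2) + 2 * (ennreal \<bar>f x\<bar> * ennreal \<bar>f (x + h)\<bar>)" for x
  proof -
    have "(f (x + h))\<^sup>2 + (f x)\<^sup>2 \<le> (f (x + h) - f x)\<^sup>2 + 2 * (\<bar>f x\<bar> * \<bar>f (x + h)\<bar>)"
      using abs_ge_self[of "f x * f (x + h)"] by (simp add: power2_diff abs_mult mult.commute)
    then have "ennreal ((f (x + h))\<^sup>2 + (f x)\<^sup>2)
        \<le> ennreal ((f (x + h) - f x)\<^sup>2 + 2 * (\<bar>f x\<bar> * \<bar>f (x + h)\<bar>))"
      by (rule ennreal_leI)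
    then show ?thesis by (simp add: ennreal_mult)
  qed
  then have "(\<integral>\<^sup>+x. ennreal ((f (x + h))\<^sup>2) + ennreal ((f x)\<^sup>2) \<partial>lborel)
      \<le> (\<integral>\<^sup>+x. ennreal ((f (x + h) - f x)\<^sup>2) + 2 * (ennreal \<bar>f x\<bar> * ennreal \<bar>f (x + h)\<bar>) \<partial>lborel)"
    by (rule nn_integral_mono)
  then have "2 * (\<integral>\<^sup>+x. ennreal ((f x)\<^sup>2) \<partial>lborel)
      \<le> (\<integral>\<^sup>+x. ennreal ((f (x + h) - f x)\<^sup>2) \<partial>lborel)
        + 2 * (\<integral>\<^sup>+x. ennreal \<bar>f x\<bar> * ennreal \<bar>f (x + h)\<bar> \<partial>lborel)"
    by (simp add: nn_integral_add nn_integral_cmult mult_2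
        nn_integral_lborel_translate[where g = "\<lambda>x. ennreal ((f x)\<^sup>2)"])
  also note add_right_mono[OF nn_integral_translation_diff_square_le[OF f]]
  finally show ?thesis .
qed

theorem Nash_inequality:
  fixes f :: "'a::euclidean_space \<Rightarrow> real"
  assumes f: "smooth_fun f" and R: "0 \<le> R"
  defines "V \<equiv> emeasure lborel (ball (0::'a) R)"
  shows "2 * (V * (\<integral>\<^sup>+x. ennreal ((f x)\<^sup>2) \<partial>lborel))
    \<le> V * (ennreal (R\<^sup>2) * (\<integral>\<^sup>+x. ennreal ((norm (grad f x))\<^sup>2) \<partial>lborel))
       + 2 * (\<integral>\<^sup>+x. ennreal \<bar>f x\<bar> \<partial>lborel)\<^sup>2"
proof -
  let ?I = "indicator (ball (0::'a) R) :: 'a \<Rightarrow> ennreal"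
  let ?S = "\<integral>\<^sup>+x. ennreal ((f x)\<^sup>2) \<partial>lborel"
    and ?D = "\<integral>\<^sup>+x. ennreal ((norm (grad f x))\<^sup>2) \<partial>lborel"
    and ?A = "\<lambda>h. \<integral>\<^sup>+x. ennreal \<bar>f x\<bar> * ennreal \<bar>f (x + h)\<bar> \<partial>lborel"
  note [measurable] = smooth_fun_borel_measurable[OF f]
  have [measurable]: "?I \<in> borel_measurable borel"
    by (intro borel_measurable_indicator borel_open open_ball)
  have "2 * ?S * ?I h \<le> ennreal (R\<^sup>2) * ?D * ?I h + 2 * ?A h" for h
  proof (cases "h \<in> ball 0 R")
    case True
    then have "ennreal ((norm h)\<^sup>2) * ?D \<le> ennreal (R\<^sup>2) * ?D"
      by (intro mult_right_mono ennreal_leI power_mono) auto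
    from order_trans[OF nn_integral_square_le_autocorrelation[OF f] add_right_mono[OF this]]
    show ?thesis using True by simp
  qed simp
  then have "(\<integral>\<^sup>+h. 2 * ?S * ?I h \<partial>lborel) \<le> (\<integral>\<^sup>+h. ennreal (R\<^sup>2) * ?D * ?I h + 2 * ?A h \<partial>lborel)"
    by (rule nn_integral_mono)
  also have "\<dots> = ennreal (R\<^sup>2) * ?D * V + 2 * (\<integral>\<^sup>+h. ?A h \<partial>lborel)"
    by (subst nn_integral_add; (measurable)?)
      (simp add: nn_integral_cmult nn_integral_cmult_indicator V_def)
  also have "(\<integral>\<^sup>+h. ?A h \<partial>lborel) = (\<integral>\<^sup>+x. ennreal \<bar>f x\<bar> \<partial>lborel)\<^sup>2"
    by (rule nn_integral_autocorrelation) measurable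
  also have "(\<integral>\<^sup>+h. 2 * ?S * ?I h \<partial>lborel) = 2 * ?S * V"
    unfolding V_def by (rule nn_integral_cmult_indicator) simp
  finally show ?thesis by (simp add: mult_ac)
qed

section \<open>The Sobolev space of a set of finite measure\<close>

lemma test_fun_square_integrable:
  fixes f :: "'a::euclidean_space \<Rightarrow> real"
  assumes f: "test_fun \<Omega> f" and S: "S \<in> lmeasurable"
  shows "square_integrable (lebesgue_on S) f" "square_integrable (lebesgue_on S) (grad f)"
proof -
  interpret finite_measure "lebesgue_on S" using S by (rule finite_measure_lebesgue_on)
  obtain B where B: "\<And>x. norm (f x) \<le> B" "\<And>x. norm (grad f x) \<le> B"
    using test_fun_bounded[OF f] by blast
  have "f \<in> borel_measurable (lebesgue_on S)" "grad f \<in> borel_measurable (lebesgue_on S)"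
    using smooth_fun_borel_measurable[OF test_funD(1)[OF f]]
    by (simp_all add: measurable_restrict_space1 measurable_completion)
  then show "square_integrable (lebesgue_on S) f" "square_integrable (lebesgue_on S) (grad f)"
    using B by (blast intro: square_integrable_bounded)+
qed

lemma nn_integral_lborel_eq_lebesgue_on:
  assumes "\<Omega> \<in> sets lebesgue" "\<And>x. x \<notin> \<Omega> \<Longrightarrow> g x = 0"
  shows "(\<integral>\<^sup>+x. g x \<partial>lborel) = (\<integral>\<^sup>+x. g x \<partial>lebesgue_on \<Omega>)"
proof -
  have "(\<integral>\<^sup>+x. g x \<partial>lborel) = (\<integral>\<^sup>+x. g x * indicator \<Omega> x \<partial>lebesgue)"
    unfolding nn_integral_completion[of lborel, symmetric]
    by (intro nn_integral_cong) (use assms(2) in \<open>auto split: split_indicator\<close>)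
  then show ?thesis using assms(1) by (simp add: nn_integral_restrict_space)
qed

lemma Nash_inequality_L2:
  fixes f :: "'a::euclidean_space \<Rightarrow> real"
  assumes f: "test_fun \<Omega> f" and \<Omega>: "\<Omega> \<in> lmeasurable" and R: "0 \<le> R"
  defines "V \<equiv> measure lborel (ball (0::'a) R)"
  shows "2 * V * (L2_norm (lebesgue_on \<Omega>) f)\<^sup>2
    \<le> V * R\<^sup>2 * (L2_norm (lebesgue_on \<Omega>) (grad f))\<^sup>2 + 2 * (\<integral>x. \<bar>f x\<bar> \<partial>lebesgue_on \<Omega>)\<^sup>2"
proof -
  interpret finite_measure "lebesgue_on \<Omega>" using \<Omega> by (rule finite_measure_lebesgue_on)
  note on_\<Omega> = nn_integral_lborel_eq_lebesgue_on[OF fmeasurableD[OF \<Omega>]]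
  note sq = test_fun_square_integrable[OF f \<Omega>]
  let ?S = "(L2_norm (lebesgue_on \<Omega>) f)\<^sup>2" and ?D = "(L2_norm (lebesgue_on \<Omega>) (grad f))\<^sup>2"
    and ?L = "\<integral>x. \<bar>f x\<bar> \<partial>lebesgue_on \<Omega>"
  have V: "emeasure lborel (ball (0::'a) R) = ennreal V" "0 \<le> V"
    using emeasure_lborel_ball_finite[of "0::'a" R]
    by (auto simp: V_def emeasure_eq_ennreal_measure)
  have "(\<integral>\<^sup>+x. ennreal ((f x)\<^sup>2) \<partial>lborel) = ennreal ?S"
    using nn_integral_eq_L2_norm[OF sq(1)] by (subst on_\<Omega>) (simp_all add: test_funD(4)[OF f])
  moreover have "(\<integral>\<^sup>+x. ennreal ((norm (grad f x))\<^sup>2) \<partial>lborel) = ennreal ?D"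
    using nn_integral_eq_L2_norm[OF sq(2)] by (subst on_\<Omega>) (simp_all add: test_funD(5)[OF f])
  moreover have "(\<integral>\<^sup>+x. ennreal \<bar>f x\<bar> \<partial>lborel) = ennreal ?L"
    using square_integrable_imp_integrable_norm[OF sq(1)]
    by (subst on_\<Omega>) (simp_all add: test_funD(4)[OF f] nn_integral_eq_integral)
  ultimately have "2 * (ennreal V * ennreal ?S)
      \<le> ennreal V * (ennreal (R\<^sup>2) * ennreal ?D) + 2 * (ennreal ?L)\<^sup>2"
    using Nash_inequality[OF test_funD(1)[OF f] R] V(1) by simp
  also have "\<dots> = ennreal (V * R\<^sup>2 * ?D + 2 * ?L\<^sup>2)"
    using V(2) by (simp add: ennreal_mult ennreal_power mult.assoc)
  also have "2 * (ennreal V * ennreal ?S) = ennreal (2 * V * ?S)"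
    using V(2) by (simp add: ennreal_mult mult.assoc)
  finally show ?thesis
    by (subst (asm) ennreal_le_iff) (use V(2) in auto)
qed

lemma unit_ball_vol_of_nat_neq_0 [simp]: "unit_ball_vol (real n) \<noteq> 0"
  by (metis less_irrefl of_nat_0_le_iff unit_ball_vol_pos)

definition volume_radius :: "'a::euclidean_space itself \<Rightarrow> real \<Rightarrow> real" where
  "volume_radius _ b = (b / unit_ball_vol (real DIM('a))) powr (1 / DIM('a))"

lemma volume_radius_pos:
  assumes "0 < b"
  shows "0 < volume_radius TYPE('a::euclidean_space) b"
  using assms by (simp add: volume_radius_def)

lemma measure_ball_volume_radius:
  assumes "0 < b"
  shows "measure lborel (ball (0::'a::euclidean_space) (volume_radius TYPE('a) b)) = b"
proof -
  have "(x powr (1 / DIM('a))) ^ DIM('a) = x" if "0 < x" for x :: real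
    using that by (simp add: powr_realpow[symmetric] powr_powr)
  moreover have "0 < b / unit_ball_vol (real DIM('a))"
    using assms by simp
  ultimately have "volume_radius TYPE('a) b ^ DIM('a) = b / unit_ball_vol (real DIM('a))"
    unfolding volume_radius_def by blast
  then show ?thesis
    using volume_radius_pos[OF assms, where 'a = 'a] by (simp add: content_ball)
qed

lemma volume_radius_power2:
  assumes "0 < b"
  shows "(volume_radius TYPE('a::euclidean_space) b)\<^sup>2
    = (b / unit_ball_vol (real DIM('a))) powr (2 / DIM('a))"
proof -
  have "b / unit_ball_vol (real DIM('a)) \<noteq> 0"
    using assms by simp
  then show ?thesis
    unfolding volume_radius_def by (subst powr_power) auto
qed

definition Poincare_constant :: "'a::euclidean_space set \<Rightarrow> real \<Rightarrow> bool" where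
  "Poincare_constant \<Omega> R \<longleftrightarrow> 0 \<le> R \<and> (\<forall>u. test_fun \<Omega> u \<longrightarrow>
    L2_norm (lebesgue_on \<Omega>) u \<le> R * L2_norm (lebesgue_on \<Omega>) (grad u))"

text \<open>In Nash's inequality with \<open>V \<ge> 2 \<bar>\<Omega>\<bar>\<close> the Cauchy--Schwarz bound \<open>(\<integral> \<bar>f\<bar>)\<^sup>2 \<le> \<bar>\<Omega>\<bar> \<integral> f\<^sup>2\<close>
  lets the left-hand side absorb the last term.\<close>
theorem Poincare_inequality:
  fixes \<Omega> :: "'a::euclidean_space set"
  assumes \<Omega>: "\<Omega> \<in> lmeasurable"
  obtains R where "Poincare_constant \<Omega> R"
proof
  interpret finite_measure "lebesgue_on \<Omega>" using \<Omega> by (rule finite_measure_lebesgue_on)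
  define m where "m = measure (lebesgue_on \<Omega>) (space (lebesgue_on \<Omega>))"
  have m: "0 \<le> m" by (simp add: m_def)
  define R where "R = volume_radius TYPE('a) (2 * m + 1)"
  have R: "0 \<le> R" "measure lborel (ball (0::'a) R) = 2 * m + 1"
    using m by (simp_all add: R_def measure_ball_volume_radius volume_radius_pos less_imp_le)
  have "L2_norm (lebesgue_on \<Omega>) f \<le> R * L2_norm (lebesgue_on \<Omega>) (grad f)"
    if f: "test_fun \<Omega> f" for f
  proof (rule power2_le_imp_le)
    let ?s = "L2_norm (lebesgue_on \<Omega>) f" and ?d = "L2_norm (lebesgue_on \<Omega>) (grad f)"
    have "(\<integral>x. \<bar>f x\<bar> \<partial>lebesgue_on \<Omega>)\<^sup>2 \<le> (sqrt m * ?s)\<^sup>2"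
      using integral_norm_le_L2_norm[OF test_fun_square_integrable(1)[OF f \<Omega>]]
      by (intro power_mono) (auto simp: m_def)
    then have "2 * (2 * m + 1) * ?s\<^sup>2 \<le> (2 * m + 1) * R\<^sup>2 * ?d\<^sup>2 + 2 * (m * ?s\<^sup>2)"
      using Nash_inequality_L2[OF f \<Omega> R(1)] m by (simp add: R(2) power_mult_distrib)
    also have "2 * (m * ?s\<^sup>2) \<le> (2 * m + 1) * ?s\<^sup>2"
      by (simp add: algebra_simps)
    finally have "(2 * m + 1) * ?s\<^sup>2 \<le> (2 * m + 1) * (R * ?d)\<^sup>2"
      by (simp add: algebra_simps power_mult_distrib)
    then show "?s\<^sup>2 \<le> (R * ?d)\<^sup>2" using m by simp
  qed (use R(1) in simp)
  then show "Poincare_constant \<Omega> R"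
    using R(1) by (simp add: Poincare_constant_def)
qed

lemma H01_iff:
  assumes \<Omega>: "\<Omega> \<in> lmeasurable"
  shows "H01 \<Omega> u G \<longleftrightarrow> u \<in> borel_measurable lebesgue \<and> G \<in> borel_measurable lebesgue \<and>
    square_integrable (lebesgue_on \<Omega>) u \<and> square_integrable (lebesgue_on \<Omega>) G \<and>
    (\<exists>\<phi>. (\<forall>k. test_fun \<Omega> (\<phi> k)) \<and> L2_tendsto (lebesgue_on \<Omega>) \<phi> u \<and>
      L2_tendsto (lebesgue_on \<Omega>) (\<lambda>k. grad (\<phi> k)) G)"
proof -
  have on_\<Omega>: "(\<integral>\<^sup>+x\<in>\<Omega>. g x \<partial>lebesgue) = (\<integral>\<^sup>+x. g x \<partial>lebesgue_on \<Omega>)" for g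
    using \<Omega> by (simp add: nn_integral_restrict_space)
  have L2: "(\<lambda>k. \<integral>\<^sup>+x. ennreal ((u x - \<phi> k x)\<^sup>2) \<partial>lebesgue_on \<Omega>) \<longlonglongrightarrow> 0 \<longleftrightarrow>
      square_integrable (lebesgue_on \<Omega>) u \<and> L2_tendsto (lebesgue_on \<Omega>) \<phi> u"
    "(\<lambda>k. \<integral>\<^sup>+x. ennreal ((norm (G x - grad (\<phi> k) x))\<^sup>2) \<partial>lebesgue_on \<Omega>) \<longlonglongrightarrow> 0 \<longleftrightarrow>
      square_integrable (lebesgue_on \<Omega>) G \<and> L2_tendsto (lebesgue_on \<Omega>) (\<lambda>k. grad (\<phi> k)) G"
    if "u \<in> borel_measurable lebesgue" "G \<in> borel_measurable lebesgue" "\<forall>k. test_fun \<Omega> (\<phi> k)" for \<phi>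
    using nn_integral_L2_tendsto_0_iff[OF test_fun_square_integrable(1)[OF _ \<Omega>], of "\<lambda>_. \<Omega>" \<phi> u]
      nn_integral_L2_tendsto_0_iff[OF test_fun_square_integrable(2)[OF _ \<Omega>], of "\<lambda>_. \<Omega>" \<phi> G] that
    by (simp_all add: measurable_restrict_space1)
  show ?thesis
    unfolding H01_def on_\<Omega> using L2 by blast
qed

lemma H01_uminus:
  assumes \<Omega>: "\<Omega> \<in> lmeasurable" and H: "H01 \<Omega> u G"
  shows "H01 \<Omega> (\<lambda>x. - u x) (\<lambda>x. - G x)"
proof -
  obtain \<phi> where \<phi>: "\<And>k. test_fun \<Omega> (\<phi> k)"
    and lim: "L2_tendsto (lebesgue_on \<Omega>) \<phi> u"
      "L2_tendsto (lebesgue_on \<Omega>) (\<lambda>k. grad (\<phi> k)) G"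
    using H unfolding H01_iff[OF \<Omega>] by blast
  have "L2_tendsto (lebesgue_on \<Omega>) (\<lambda>k x. - \<phi> k x) (\<lambda>x. - u x)"
    "L2_tendsto (lebesgue_on \<Omega>) (\<lambda>k. grad (\<lambda>x. - \<phi> k x)) (\<lambda>x. - G x)"
    using lim L2_norm_minus_commute[of _ _ u] L2_norm_minus_commute[of _ _ G]
    by (simp_all add: test_fun_uminus(2)[OF \<phi>])
  moreover have "square_integrable (lebesgue_on \<Omega>) (\<lambda>x. - u x)"
    "square_integrable (lebesgue_on \<Omega>) (\<lambda>x. - G x)"
    using H unfolding H01_iff[OF \<Omega>] by (simp_all add: square_integrable_def)
  ultimately show ?thesis
    unfolding H01_iff[OF \<Omega>] using H test_fun_uminus(1)[OF \<phi>]
    by (intro conjI exI[of _ "\<lambda>k x. - \<phi> k x"] allI) (auto simp: H01_def)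
qed

section \<open>Existence of weak solutions\<close>

text \<open>The weak form of \<open>- \<Delta>v = f\<close> in \<open>H\<^sub>0\<^sup>1(\<Omega>)\<close>, with \<open>G\<close> the weak gradient of \<open>v\<close>.\<close>
definition weak_solution ::
    "'a::euclidean_space set \<Rightarrow> ('a \<Rightarrow> real) \<Rightarrow> ('a \<Rightarrow> real) \<Rightarrow> ('a \<Rightarrow> 'a) \<Rightarrow> bool" where
  "weak_solution \<Omega> f v G \<longleftrightarrow> H01 \<Omega> v G \<and> (\<forall>\<phi>. test_fun \<Omega> \<phi> \<longrightarrow>
    (\<integral>x. G x \<bullet> grad \<phi> x \<partial>lebesgue_on \<Omega>) = (\<integral>x. f x * \<phi> x \<partial>lebesgue_on \<Omega>))"

locale quadratic_minimization =
  fixes T :: "('b \<Rightarrow> real) set" and a :: "('b \<Rightarrow> real) \<Rightarrow> ('b \<Rightarrow> real) \<Rightarrow> real"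
    and l :: "('b \<Rightarrow> real) \<Rightarrow> real" and C :: real
  assumes nonempty: "T \<noteq> {}"
    and add_scale_mem: "u \<in> T \<Longrightarrow> w \<in> T \<Longrightarrow> (\<lambda>x. u x + t * w x) \<in> T"
    and form_add_scale: "u \<in> T \<Longrightarrow> w \<in> T \<Longrightarrow>
      a (\<lambda>x. u x + t * w x) (\<lambda>x. u x + t * w x) = a u u + 2 * t * a u w + t\<^sup>2 * a w w"
    and functional_add_scale: "u \<in> T \<Longrightarrow> w \<in> T \<Longrightarrow> l (\<lambda>x. u x + t * w x) = l u + t * l w"
    and form_nonneg: "u \<in> T \<Longrightarrow> 0 \<le> a u u"
    and functional_bound: "u \<in> T \<Longrightarrow> (l u)\<^sup>2 \<le> C * a u u" "0 \<le> C"
begin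

definition energy :: "('b \<Rightarrow> real) \<Rightarrow> real" where
  "energy u = a u u / 2 - l u"

definition energy_inf :: real where
  "energy_inf = Inf (energy ` T)"

lemma energy_add_scale:
  "u \<in> T \<Longrightarrow> w \<in> T \<Longrightarrow>
    energy (\<lambda>x. u x + t * w x) = energy u + t * (a u w - l w) + t\<^sup>2 / 2 * a w w"
  by (simp add: energy_def form_add_scale functional_add_scale field_simps)

lemma energy_lower_bound:
  assumes u: "u \<in> T"
  shows "- C / 2 \<le> energy u"
proof -
  have "4 * (C * a u u) \<le> (C + a u u)\<^sup>2"
    using zero_le_power2[of "C - a u u"] by (simp add: power2_eq_square algebra_simps)
  then have "(l u)\<^sup>2 \<le> ((C + a u u) / 2)\<^sup>2"
    using functional_bound(1)[OF u] by (simp add: power_divide)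
  then have "l u \<le> (C + a u u) / 2"
    using functional_bound(2) form_nonneg[OF u] by (intro power2_le_imp_le[of "l u"]) auto
  then show ?thesis by (simp add: energy_def field_simps)
qed

lemma bdd_below_energy: "bdd_below (energy ` T)"
  using energy_lower_bound by (rule bdd_belowI2)

lemma energy_inf_le: "u \<in> T \<Longrightarrow> energy_inf \<le> energy u"
  unfolding energy_inf_def using bdd_below_energy by (intro cInf_lower) auto

lemma near_minimizer_exists:
  assumes "0 < \<epsilon>"
  obtains u where "u \<in> T" "energy u \<le> energy_inf + \<epsilon>"
  using cInf_less_iff[of "energy ` T" "energy_inf + \<epsilon>"] nonempty bdd_below_energy assms
  by (force simp: energy_inf_def)

text \<open>Compare the energies of \<open>u\<close>, \<open>w\<close> and their midpoint.\<close>
lemma near_minimizers_close: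
  assumes u: "u \<in> T" "energy u \<le> energy_inf + \<epsilon>" and w: "w \<in> T" "energy w \<le> energy_inf + \<delta>"
  shows "a (\<lambda>x. u x - w x) (\<lambda>x. u x - w x) \<le> 4 * (\<epsilon> + \<delta>)"
proof -
  define d where "d = (\<lambda>x. u x - w x)"
  have d: "d \<in> T" using add_scale_mem[OF u(1) w(1), of "- 1"] by (simp add: d_def)
  have "energy w = energy u - (a u d - l d) + a d d / 2"
    using energy_add_scale[OF u(1) d, of "- 1"] by (simp add: d_def)
  moreover have "energy_inf \<le> energy u - (a u d - l d) / 2 + a d d / 8"
    using energy_inf_le[OF add_scale_mem[OF u(1) d, of "- 1 / 2"]]
      energy_add_scale[OF u(1) d, of "- 1 / 2"] by (simp add: power2_eq_square)
  ultimately have "a d d \<le> 4 * (\<epsilon> + \<delta>)" using u(2) w(2) by argo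
  then show ?thesis by (simp add: d_def)
qed

text \<open>Compare the energies of \<open>u\<close> and \<open>u + t w\<close> for the best \<open>t\<close>; the summand 1 avoids
  division by 0.\<close>
lemma near_minimizer_almost_critical:
  assumes u: "u \<in> T" "energy u \<le> energy_inf + \<epsilon>" and w: "w \<in> T"
  shows "(a u w - l w)\<^sup>2 \<le> 2 * (a w w + 1) * \<epsilon>"
proof -
  define X c where "X = a u w - l w" and "c = a w w + 1"
  have c: "0 < c" "a w w \<le> c" using form_nonneg[OF w] by (auto simp: c_def)
  have "energy_inf \<le> energy u + - X / c * X + (- X / c)\<^sup>2 / 2 * a w w"
    using energy_inf_le[OF add_scale_mem[OF u(1) w, of "- X / c"]]
      energy_add_scale[OF u(1) w, of "- X / c"] by (simp add: X_def)
  also have "\<dots> \<le> energy u + - X / c * X + (- X / c)\<^sup>2 / 2 * c"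
    using c by (intro add_left_mono mult_left_mono) auto
  also have "\<dots> = energy u - X\<^sup>2 / (2 * c)"
    using c(1) by (simp add: power2_eq_square field_simps)
  finally have "X\<^sup>2 / (2 * c) \<le> \<epsilon>" using u(2) by simp
  then have "X\<^sup>2 \<le> \<epsilon> * (2 * c)" using c(1) by (simp add: pos_divide_le_eq)
  then show ?thesis by (simp add: X_def c_def mult.commute)
qed

lemma minimizing_sequence:
  obtains s where "\<And>n. s n \<in> T"
    "\<And>e. 0 < e \<Longrightarrow> \<exists>N. \<forall>m\<ge>N. \<forall>n\<ge>N. a (\<lambda>x. s m x - s n x) (\<lambda>x. s m x - s n x) \<le> e"
    "\<And>w. w \<in> T \<Longrightarrow> (\<lambda>n. a (s n) w) \<longlonglongrightarrow> l w"
proof -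
  have "\<exists>u\<in>T. energy u \<le> energy_inf + 1 / real (Suc n)" for n
    using near_minimizer_exists[of "1 / real (Suc n)"] by auto
  then obtain s where s: "\<And>n. s n \<in> T" "\<And>n. energy (s n) \<le> energy_inf + 1 / real (Suc n)"
    by metis
  have "\<exists>N. \<forall>m\<ge>N. \<forall>n\<ge>N. a (\<lambda>x. s m x - s n x) (\<lambda>x. s m x - s n x) \<le> e"
    if e: "0 < e" for e
  proof -
    obtain N where N: "1 / real (Suc N) < e / 8"
      using nat_approx_posE[of "e / 8"] e by auto
    have "energy (s n) \<le> energy_inf + e / 8" if "N \<le> n" for n
    proof -
      have "1 / real (Suc n) \<le> 1 / real (Suc N)"
        using that by (intro divide_left_mono) auto
      then show ?thesis using s(2)[of n] N by linarith
    qed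
    then have "a (\<lambda>x. s m x - s n x) (\<lambda>x. s m x - s n x) \<le> e" if "N \<le> m" "N \<le> n" for m n
      using near_minimizers_close[of "s m" "e / 8" "s n" "e / 8"] s(1) that by simp
    then show ?thesis by blast
  qed
  moreover have "(\<lambda>n. a (s n) w) \<longlonglongrightarrow> l w" if w: "w \<in> T" for w
  proof (rule LIM_zero_cancel, rule Lim_null_comparison)
    show "\<forall>\<^sub>F n in sequentially. norm (a (s n) w - l w)
        \<le> sqrt (2 * (a w w + 1) * (1 / real (Suc n)))"
      using near_minimizer_almost_critical[OF s w] by (simp add: real_le_rsqrt)
    have "(\<lambda>n. 2 * (a w w + 1) * (1 / real (Suc n))) \<longlonglongrightarrow> 0"
      using tendsto_mult_right_zero[OF LIMSEQ_Suc[OF lim_1_over_n]] by blast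
    then show "(\<lambda>n. sqrt (2 * (a w w + 1) * (1 / real (Suc n)))) \<longlonglongrightarrow> 0"
      using tendsto_real_sqrt by fastforce
  qed
  ultimately show ?thesis using that s(1) by blast
qed

end

lemma Dirichlet_form_quadratic_minimization:
  fixes \<Omega> :: "'a::euclidean_space set"
  assumes \<Omega>: "\<Omega> \<in> lmeasurable" and f: "square_integrable (lebesgue_on \<Omega>) f"
    and R: "Poincare_constant \<Omega> R"
  shows "quadratic_minimization {u. test_fun \<Omega> u}
    (\<lambda>u w. \<integral>x. grad u x \<bullet> grad w x \<partial>lebesgue_on \<Omega>) (\<lambda>u. \<integral>x. f x * u x \<partial>lebesgue_on \<Omega>)
    ((L2_norm (lebesgue_on \<Omega>) f * R)\<^sup>2)"
proof
  let ?M = "lebesgue_on \<Omega>"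
  have sq: "square_integrable ?M u" "square_integrable ?M (grad u)" if "test_fun \<Omega> u" for u
    using test_fun_square_integrable[OF that \<Omega>] .
  show "{u :: 'a \<Rightarrow> real. test_fun \<Omega> u} \<noteq> {}"
    using test_fun_zero by blast
  show "0 \<le> (L2_norm ?M f * R)\<^sup>2" by simp
  fix u assume u: "u \<in> {u. test_fun \<Omega> u}"
  show "0 \<le> (\<integral>x. grad u x \<bullet> grad u x \<partial>?M)" by simp
  have "\<bar>\<integral>x. f x * u x \<partial>?M\<bar> \<le> L2_norm ?M f * L2_norm ?M u"
    using Cauchy_Schwarz_L2[OF f sq(1)] u by simp
  also have "\<dots> \<le> L2_norm ?M f * (R * L2_norm ?M (grad u))"
    using u R by (intro mult_left_mono) (auto simp: Poincare_constant_def)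
  finally show "(\<integral>x. f x * u x \<partial>?M)\<^sup>2 \<le> (L2_norm ?M f * R)\<^sup>2 * (\<integral>x. grad u x \<bullet> grad u x \<partial>?M)"
    unfolding L2_norm_power2_inner[symmetric] power_mult_distrib[symmetric] using R
    by (subst abs_le_square_iff[symmetric]) (simp add: Poincare_constant_def mult.assoc)
  fix w and t :: real assume w: "w \<in> {u. test_fun \<Omega> u}"
  show "(\<lambda>x. u x + t * w x) \<in> {u. test_fun \<Omega> u}"
    using u w test_fun_add_scale by blast
  show "(\<integral>x. grad (\<lambda>x. u x + t * w x) x \<bullet> grad (\<lambda>x. u x + t * w x) x \<partial>?M)
      = (\<integral>x. grad u x \<bullet> grad u x \<partial>?M) + 2 * t * (\<integral>x. grad u x \<bullet> grad w x \<partial>?M)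
        + t\<^sup>2 * (\<integral>x. grad w x \<bullet> grad w x \<partial>?M)"
    using L2_norm_add_scaleR_power2[OF sq(2) sq(2), of u w t] u w
    by (simp add: L2_norm_power2_inner grad_add_scale test_funD(1))
  show "(\<integral>x. f x * (u x + t * w x) \<partial>?M) = (\<integral>x. f x * u x \<partial>?M) + t * (\<integral>x. f x * w x \<partial>?M)"
    using integrable_inner[OF f sq(1), of u] integrable_inner[OF f sq(1), of w] u w
    by (simp add: distrib_left mult.left_commute[of _ t])
qed

lemma H01_L2_limit:
  fixes \<Omega> :: "'a::euclidean_space set"
  assumes \<Omega>: "\<Omega> \<in> lmeasurable" and s: "\<And>n. test_fun \<Omega> (s n)"
    and v: "square_integrable (lebesgue_on \<Omega>) v" "L2_tendsto (lebesgue_on \<Omega>) s v"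
    and G: "square_integrable (lebesgue_on \<Omega>) G"
      "L2_tendsto (lebesgue_on \<Omega>) (\<lambda>n. grad (s n)) G"
  shows "H01 \<Omega> (\<lambda>x. if x \<in> \<Omega> then v x else 0) (\<lambda>x. if x \<in> \<Omega> then G x else 0)"
proof -
  have extend: "(\<lambda>x. if x \<in> \<Omega> then g x else 0) \<in> borel_measurable lebesgue"
    "square_integrable (lebesgue_on \<Omega>) (\<lambda>x. if x \<in> \<Omega> then g x else 0)"
    if "square_integrable (lebesgue_on \<Omega>) g" for g :: "'a \<Rightarrow> 'b::euclidean_space"
    using square_integrable_cong[of "lebesgue_on \<Omega>" "\<lambda>x. if x \<in> \<Omega> then g x else 0" g]
      borel_measurable_if_I[OF square_integrable_measurable[OF that] fmeasurableD[OF \<Omega>]] that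
    by simp_all
  have diff: "L2_norm (lebesgue_on \<Omega>) (\<lambda>x. h x - (if x \<in> \<Omega> then g x else 0)) =
      L2_norm (lebesgue_on \<Omega>) (\<lambda>x. h x - g x)" for h g :: "'a \<Rightarrow> 'b::euclidean_space"
    by (rule L2_norm_cong) simp
  show ?thesis
    unfolding H01_iff[OF \<Omega>] using extend[OF v(1)] extend[OF G(1)] s v(2) G(2)
    by (intro conjI exI[of _ s] allI) (simp_all add: diff)
qed

lemma test_functions_L2_Cauchy:
  fixes s :: "nat \<Rightarrow> 'a::euclidean_space \<Rightarrow> real"
  assumes s: "\<And>n. test_fun \<Omega> (s n)" and R: "Poincare_constant \<Omega> R"
    and Cauchy: "L2_Cauchy (lebesgue_on \<Omega>) (\<lambda>n. grad (s n))"
  shows "L2_Cauchy (lebesgue_on \<Omega>) s"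
  unfolding L2_Cauchy_def
proof (intro allI impI)
  let ?M = "lebesgue_on \<Omega>"
  fix e :: real assume "0 < e"
  define \<delta> where "\<delta> = e / (R + 1)"
  have \<delta>: "0 < \<delta>" "R * \<delta> \<le> e"
    using \<open>0 < e\<close> R by (auto simp: Poincare_constant_def \<delta>_def field_simps)
  obtain N where N: "\<And>m n. N \<le> m \<Longrightarrow> N \<le> n \<Longrightarrow> L2_norm ?M (\<lambda>x. grad (s m) x - grad (s n) x) \<le> \<delta>"
    using Cauchy \<delta>(1) unfolding L2_Cauchy_def by blast
  have "L2_norm ?M (\<lambda>x. s m x - s n x) \<le> e" if "N \<le> m" "N \<le> n" for m n
  proof -
    have "L2_norm ?M (\<lambda>x. s m x - s n x) \<le> R * L2_norm ?M (grad (\<lambda>x. s m x - s n x))"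
      using R test_fun_diff[OF s s] by (simp add: Poincare_constant_def)
    also have "grad (\<lambda>x. s m x - s n x) = (\<lambda>x. grad (s m) x - grad (s n) x)"
      using test_funD(1)[OF s] by (intro ext grad_diff)
    also have "R * L2_norm ?M (\<lambda>x. grad (s m) x - grad (s n) x) \<le> R * \<delta>"
      using N[OF that] R by (simp add: Poincare_constant_def mult_left_mono)
    also note \<delta>(2)
    finally show ?thesis .
  qed
  then show "\<exists>N. \<forall>m\<ge>N. \<forall>n\<ge>N. L2_norm ?M (\<lambda>x. s m x - s n x) \<le> e" by blast
qed

lemma Dirichlet_minimizing_sequence:
  fixes \<Omega> :: "'a::euclidean_space set"
  assumes \<Omega>: "\<Omega> \<in> lmeasurable" and f: "square_integrable (lebesgue_on \<Omega>) f"
    and R: "Poincare_constant \<Omega> R"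
  obtains s where "\<And>n. test_fun \<Omega> (s n)" "L2_Cauchy (lebesgue_on \<Omega>) (\<lambda>n. grad (s n))"
    "\<And>\<phi>. test_fun \<Omega> \<phi> \<Longrightarrow> (\<lambda>n. \<integral>x. grad (s n) x \<bullet> grad \<phi> x \<partial>lebesgue_on \<Omega>)
      \<longlonglongrightarrow> (\<integral>x. f x * \<phi> x \<partial>lebesgue_on \<Omega>)"
proof -
  let ?M = "lebesgue_on \<Omega>"
  interpret quadratic_minimization "{u. test_fun \<Omega> u}"
    "\<lambda>u w. \<integral>x. grad u x \<bullet> grad w x \<partial>?M" "\<lambda>u. \<integral>x. f x * u x \<partial>?M" "(L2_norm ?M f * R)\<^sup>2"
    by (rule Dirichlet_form_quadratic_minimization[OF \<Omega> f R])
  obtain s where "\<And>n. s n \<in> {u. test_fun \<Omega> u}"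
    and close: "\<And>e. 0 < e \<Longrightarrow> \<exists>N. \<forall>m\<ge>N. \<forall>n\<ge>N.
      (\<integral>x. grad (\<lambda>x. s m x - s n x) x \<bullet> grad (\<lambda>x. s m x - s n x) x \<partial>?M) \<le> e"
    and lim: "\<And>\<phi>. \<phi> \<in> {u. test_fun \<Omega> u} \<Longrightarrow>
      (\<lambda>n. \<integral>x. grad (s n) x \<bullet> grad \<phi> x \<partial>?M) \<longlonglongrightarrow> (\<integral>x. f x * \<phi> x \<partial>?M)"
    by (rule minimizing_sequence) blast
  then have s: "\<And>n. test_fun \<Omega> (s n)" by simp
  have form_eq: "(\<integral>x. grad (\<lambda>x. s m x - s n x) x \<bullet> grad (\<lambda>x. s m x - s n x) x \<partial>?M)
      = (L2_norm ?M (\<lambda>x. grad (s m) x - grad (s n) x))\<^sup>2" for m n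
    by (simp add: L2_norm_power2_inner grad_diff test_funD(1)[OF s])
  have "L2_Cauchy ?M (\<lambda>n. grad (s n))"
    unfolding L2_Cauchy_def
  proof (intro allI impI)
    fix e :: real assume "0 < e"
    then show "\<exists>N. \<forall>m\<ge>N. \<forall>n\<ge>N. L2_norm ?M (\<lambda>x. grad (s m) x - grad (s n) x) \<le> e"
      using close[of "e\<^sup>2"] power2_le_imp_le[OF _ less_imp_le[OF \<open>0 < e\<close>]]
      unfolding form_eq by (meson zero_less_power)
  qed
  then show ?thesis using that[of s] s lim by simp
qed

theorem weak_solution_exists:
  fixes \<Omega> :: "'a::euclidean_space set"
  assumes \<Omega>: "\<Omega> \<in> lmeasurable" and f: "square_integrable (lebesgue_on \<Omega>) f"
  obtains v G where "weak_solution \<Omega> f v G"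
proof -
  let ?M = "lebesgue_on \<Omega>"
  note sq = test_fun_square_integrable[OF _ \<Omega>]
  obtain R where R: "Poincare_constant \<Omega> R"
    using Poincare_inequality[OF \<Omega>] .
  obtain s where s: "\<And>n. test_fun \<Omega> (s n)" and Cauchy: "L2_Cauchy ?M (\<lambda>n. grad (s n))"
    and lim: "\<And>\<phi>. test_fun \<Omega> \<phi> \<Longrightarrow>
      (\<lambda>n. \<integral>x. grad (s n) x \<bullet> grad \<phi> x \<partial>?M) \<longlonglongrightarrow> (\<integral>x. f x * \<phi> x \<partial>?M)"
    using Dirichlet_minimizing_sequence[OF \<Omega> f R] by blast
  obtain G where G: "square_integrable ?M G" "L2_tendsto ?M (\<lambda>n. grad (s n)) G"
    using L2_complete[OF sq(2)[OF s] Cauchy] by blast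
  obtain v where v: "square_integrable ?M v" "L2_tendsto ?M s v"
    using L2_complete[OF sq(1)[OF s] test_functions_L2_Cauchy[OF s R Cauchy]] by blast
  have "(\<integral>x. (if x \<in> \<Omega> then G x else 0) \<bullet> grad \<phi> x \<partial>?M) = (\<integral>x. f x * \<phi> x \<partial>?M)"
    if \<phi>: "test_fun \<Omega> \<phi>" for \<phi>
  proof -
    have "(\<integral>x. (if x \<in> \<Omega> then G x else 0) \<bullet> grad \<phi> x \<partial>?M) = (\<integral>x. G x \<bullet> grad \<phi> x \<partial>?M)"
      by (rule Bochner_Integration.integral_cong) auto
    also have "\<dots> = (\<integral>x. f x * \<phi> x \<partial>?M)"
      using integral_inner_tendsto[OF sq(2)[OF s] G(1) sq(2)[OF \<phi>] G(2)] lim[OF \<phi>]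
      by (rule LIMSEQ_unique)
    finally show ?thesis .
  qed
  then show ?thesis
    using that H01_L2_limit[OF \<Omega> s v G] by (auto simp: weak_solution_def)
qed

section \<open>Boundedness of weak solutions\<close>

lemma summable_powr_geometric:
  fixes a x s :: real
  assumes "0 \<le> a" "0 < x" "x < 1" "0 < s"
  shows "summable (\<lambda>i. (a * x ^ i) powr s)"
proof -
  have "(a * x ^ i) powr s = a powr s * (x powr s) ^ i" for i
    using assms by (simp add: powr_mult powr_power powr_realpow[symmetric] powr_powr mult.commute)
  moreover have "x powr s < 1"
    using powr_less_mono2[of s x 1] assms by simp
  ultimately show ?thesis
    by (simp add: summable_mult summable_geometric)
qed

definition superlevel_measure :: "'a measure \<Rightarrow> ('a \<Rightarrow> real) \<Rightarrow> real \<Rightarrow> real" where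
  "superlevel_measure M v k = measure M {x\<in>space M. k < v x}"

lemma (in finite_measure) superlevel_measure_antimono:
  assumes [measurable]: "v \<in> borel_measurable M" and "k \<le> k'"
  shows "superlevel_measure M v k' \<le> superlevel_measure M v k"
  unfolding superlevel_measure_def
  by (rule finite_measure_mono) (use assms(2) in \<open>auto intro: le_less_trans\<close>)

lemma (in finite_measure) AE_bounded_of_superlevel_measure_halving:
  fixes v :: "'a \<Rightarrow> real"
  assumes [measurable]: "v \<in> borel_measurable M" and C: "0 \<le> C" and s: "0 < s"
    and halving: "\<And>k b. 0 \<le> k \<Longrightarrow> 0 < b \<Longrightarrow> superlevel_measure M v k \<le> b \<Longrightarrow>
      superlevel_measure M v (k + C * b powr s) \<le> b / 2"
  shows "\<exists>K. AE x in M. v x \<le> K"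
proof -
  define b where "b n = (measure M (space M) + 1) * (1 / 2) ^ n" for n
  have b: "0 < b n" "b (Suc n) = b n / 2" for n
    by (auto simp: b_def add_nonneg_pos)
  define k where "k n = (\<Sum>i<n. C * b i powr s)" for n
  define K where "K = (\<Sum>i. C * b i powr s)"
  have summable: "summable (\<lambda>i. C * b i powr s)"
    unfolding b_def using s by (intro summable_mult summable_powr_geometric) auto
  have k: "0 \<le> k n" "k n \<le> K" for n
    unfolding k_def K_def using C by (auto intro!: sum_nonneg sum_le_suminf summable)
  have level: "superlevel_measure M v (k n) \<le> b n" for n
  proof (induction n)
    case 0
    have "superlevel_measure M v (k 0) \<le> measure M (space M)"
      unfolding superlevel_measure_def by (rule finite_measure_mono) auto
    then show ?case by (simp add: b_def)
  next
    case (Suc n)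
    then show ?case using halving[OF k(1) b(1), of n n] by (simp add: k_def b(2))
  qed
  have "superlevel_measure M v K \<le> b n" for n
    using superlevel_measure_antimono[OF assms(1) k(2)] level by (rule order_trans)
  moreover have "b \<longlonglongrightarrow> (measure M (space M) + 1) * 0"
    unfolding b_def by (intro tendsto_intros LIMSEQ_power_zero) simp
  ultimately have "superlevel_measure M v K \<le> 0"
    by (intro LIMSEQ_le_const) auto
  then have "AE x in M. \<not> K < v x"
    by (subst AE_iff_measurable[OF _ refl])
      (auto simp: superlevel_measure_def emeasure_eq_measure measure_le_0_iff)
  then show ?thesis by (auto simp: not_less)
qed

lemma (in finite_measure) smooth_truncation_L2_tendsto:
  fixes v :: "'a \<Rightarrow> real"
  assumes \<phi>: "\<And>j. square_integrable M (\<phi> j)" and v: "square_integrable M v"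
    and lim: "L2_tendsto M \<phi> v"
    and k: "0 \<le> k" and e: "\<And>j. 0 \<le> e j" "e \<longlonglongrightarrow> 0"
  shows "L2_tendsto M (\<lambda>j x. smooth_truncation k (e j) (\<phi> j x)) (\<lambda>x. max 0 (v x - k))"
proof (rule Lim_null_comparison)
  note [measurable] = \<phi> v
  have const: "square_integrable M (\<lambda>x. c)" for c :: real
    by (rule square_integrable_bounded) auto
  have "L2_norm M (\<lambda>x. smooth_truncation k (e j) (\<phi> j x) - max 0 (v x - k))
      \<le> L2_norm M (\<lambda>x. \<phi> j x - v x) + e j * sqrt (measure M (space M))" for j
  proof -
    have sq: "square_integrable M (\<lambda>x. norm (\<phi> j x - v x))"
      by (intro square_integrable_norm square_integrable_diff \<phi> v)
    have "\<bar>smooth_truncation k (e j) (\<phi> j x) - max 0 (v x - k)\<bar> \<le> \<bar>\<phi> j x - v x\<bar> + e j" for x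
      using smooth_truncation_approx[OF k e(1), of j "\<phi> j x"] by linarith
    then have "L2_norm M (\<lambda>x. smooth_truncation k (e j) (\<phi> j x) - max 0 (v x - k))
        \<le> L2_norm M (\<lambda>x. norm (\<phi> j x - v x) + e j)"
      by (intro L2_norm_mono square_integrable_add sq const)
        (auto simp: smooth_truncation_def smooth_pos_part_def intro: order_trans[OF _ abs_ge_self])
    also have "\<dots> \<le> L2_norm M (\<lambda>x. norm (\<phi> j x - v x)) + L2_norm M (\<lambda>x. e j)"
      by (rule L2_norm_triangle_ineq[OF sq const])
    finally show ?thesis
      using e(1)[of j] by (simp add: L2_norm_def real_sqrt_mult mult.commute)
  qed
  then show "\<forall>\<^sub>F j in sequentially.
      norm (L2_norm M (\<lambda>x. smooth_truncation k (e j) (\<phi> j x) - max 0 (v x - k)))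
        \<le> L2_norm M (\<lambda>x. \<phi> j x - v x) + e j * sqrt (measure M (space M))"
    by simp
  show "(\<lambda>j. L2_norm M (\<lambda>x. \<phi> j x - v x) + e j * sqrt (measure M (space M))) \<longlonglongrightarrow> 0"
    using tendsto_add[OF lim tendsto_mult_left_zero[OF e(2)]] by simp
qed

lemma norm_scaleR_power2_le:
  fixes D G :: "'a::real_inner"
  assumes s: "0 \<le> s" "s \<le> 1"
  shows "(norm (s *\<^sub>R D))\<^sup>2 \<le> (norm (D - G))\<^sup>2 + norm (D - G) * norm G + G \<bullet> (s *\<^sub>R D)"
proof -
  have "(norm (s *\<^sub>R D))\<^sup>2 = s * (s * (norm D)\<^sup>2)"
    by (simp add: power_mult_distrib power2_eq_square)
  also have "\<dots> \<le> s * (norm D)\<^sup>2"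
    using s by (simp add: mult_left_le_one_le)
  also have "\<dots> = s * ((D - G) \<bullet> D) + G \<bullet> (s *\<^sub>R D)"
    by (simp add: power2_norm_eq_inner inner_diff_left algebra_simps)
  also have "s * ((D - G) \<bullet> D) \<le> s * (norm (D - G) * norm D)"
    using s by (intro mult_left_mono norm_cauchy_schwarz)
  also have "\<dots> \<le> norm (D - G) * norm D"
    using s by (simp add: mult_left_le_one_le)
  also have "\<dots> \<le> norm (D - G) * (norm (D - G) + norm G)"
    using norm_triangle_ineq[of "D - G" G] by (intro mult_left_mono) auto
  finally show ?thesis by (simp add: power2_eq_square algebra_simps)
qed

lemma L2_norm_shrunk_power2_le:
  assumes D: "square_integrable M D" and G: "square_integrable M G" and F: "square_integrable M F"
    and shrunk: "\<And>x. \<exists>s. 0 \<le> s \<and> s \<le> 1 \<and> F x = s *\<^sub>R D x"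
  shows "(L2_norm M F)\<^sup>2 \<le> (L2_norm M (\<lambda>x. D x - G x))\<^sup>2
    + L2_norm M (\<lambda>x. D x - G x) * L2_norm M G + (\<integral>x. G x \<bullet> F x \<partial>M)"
proof -
  note DG = square_integrable_diff[OF D G]
  note int = square_integrableD[OF DG] integrable_norm_mult[OF DG G] integrable_inner[OF G F]
  have "(norm (F x))\<^sup>2 \<le> (norm (D x - G x))\<^sup>2 + norm (D x - G x) * norm (G x) + G x \<bullet> F x" for x
    using shrunk[of x] norm_scaleR_power2_le by metis
  then have "(\<integral>x. (norm (F x))\<^sup>2 \<partial>M)
      \<le> (\<integral>x. (norm (D x - G x))\<^sup>2 + norm (D x - G x) * norm (G x) + G x \<bullet> F x \<partial>M)"
    using int square_integrableD[OF F] by (intro integral_mono) auto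
  then show ?thesis
    using int integral_norm_mult_le_L2_norm[OF DG G] by (simp add: L2_norm_power2)
qed

context
  fixes \<Omega> :: "'a::euclidean_space set" and f v :: "'a \<Rightarrow> real" and G :: "'a \<Rightarrow> 'a" and B :: real
  assumes \<Omega>: "\<Omega> \<in> lmeasurable" and weak: "weak_solution \<Omega> f v G"
    and f: "f \<in> borel_measurable (lebesgue_on \<Omega>)" "\<And>x. \<bar>f x\<bar> \<le> B" and B: "0 < B"
begin

interpretation finite_measure "lebesgue_on \<Omega>"
  using \<Omega> by (rule finite_measure_lebesgue_on)

private lemma solution_square_integrable:
  "square_integrable (lebesgue_on \<Omega>) v" "square_integrable (lebesgue_on \<Omega>) G"
  using weak by (auto simp: weak_solution_def H01_iff[OF \<Omega>])

private lemma truncation_square_integrable: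
  assumes "0 \<le> k"
  shows "square_integrable (lebesgue_on \<Omega>) (\<lambda>x. max 0 (v x - k))"
proof (rule square_integrable_bound[OF solution_square_integrable(1)])
  note [measurable] = solution_square_integrable(1)
  show "(\<lambda>x. max 0 (v x - k)) \<in> borel_measurable (lebesgue_on \<Omega>)" by measurable
qed (use assms in auto)

private lemma source_pairing_le:
  assumes \<psi>: "test_fun \<Omega> \<psi>"
  shows "(\<integral>x. f x * \<psi> x \<partial>lebesgue_on \<Omega>) \<le> B * (\<integral>x. \<bar>\<psi> x\<bar> \<partial>lebesgue_on \<Omega>)"
proof -
  note sq = test_fun_square_integrable(1)[OF \<psi> \<Omega>]
  have "f x * \<psi> x \<le> B * \<bar>\<psi> x\<bar>" for x
    using mult_right_mono[OF f(2)[of x] abs_ge_zero[of "\<psi> x"]] abs_ge_self[of "f x * \<psi> x"]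
    by (simp add: abs_mult)
  moreover have "integrable (lebesgue_on \<Omega>) (\<lambda>x. f x * \<psi> x)"
    using integrable_inner[OF square_integrable_bounded[OF f(1), of B] sq] f(2) by simp
  ultimately have "(\<integral>x. f x * \<psi> x \<partial>lebesgue_on \<Omega>) \<le> (\<integral>x. B * \<bar>\<psi> x\<bar> \<partial>lebesgue_on \<Omega>)"
    using square_integrable_imp_integrable_norm[OF sq] by (intro integral_mono) auto
  then show ?thesis by simp
qed

text \<open>Testing the equation with a smoothed truncation bounds its energy by its integral, because the
  derivative \<open>s\<close> of the truncation satisfies \<open>s\<^sup>2 \<le> s\<close>.\<close>
private lemma truncation_approximation:
  assumes k: "0 \<le> k"
  obtains \<psi> r where "\<And>j. test_fun \<Omega> (\<psi> j)"
    "L2_tendsto (lebesgue_on \<Omega>) \<psi> (\<lambda>x. max 0 (v x - k))" "r \<longlonglongrightarrow> 0"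
    "\<And>j. (L2_norm (lebesgue_on \<Omega>) (grad (\<psi> j)))\<^sup>2 \<le> r j + B * (\<integral>x. \<bar>\<psi> j x\<bar> \<partial>lebesgue_on \<Omega>)"
proof -
  let ?M = "lebesgue_on \<Omega>"
  obtain \<phi> where \<phi>: "\<And>j. test_fun \<Omega> (\<phi> j)"
    and lim: "L2_tendsto ?M \<phi> v" "L2_tendsto ?M (\<lambda>j. grad (\<phi> j)) G"
    using weak unfolding weak_solution_def H01_iff[OF \<Omega>] by blast
  note sq = test_fun_square_integrable[OF _ \<Omega>]
  define e where "e j = 1 / real (Suc j)" for j
  have e: "0 < e j" for j by (simp add: e_def)
  have e_lim: "e \<longlonglongrightarrow> 0" unfolding e_def using LIMSEQ_Suc[OF lim_1_over_n] .
  define \<psi> where "\<psi> j x = smooth_truncation k (e j) (\<phi> j x)" for j x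
  have \<psi>: "test_fun \<Omega> (\<psi> j)" for j
    unfolding \<psi>_def using \<phi> e by (rule test_fun_smooth_truncation)
  have shrunk: "\<exists>s. 0 \<le> s \<and> s \<le> 1 \<and> grad (\<psi> j) x = s *\<^sub>R grad (\<phi> j) x" for j x
    unfolding \<psi>_def using grad_smooth_truncation[OF test_funD(1)[OF \<phi>] e] by metis
  define r where "r j = (L2_norm ?M (\<lambda>x. grad (\<phi> j) x - G x))\<^sup>2
      + L2_norm ?M (\<lambda>x. grad (\<phi> j) x - G x) * L2_norm ?M G" for j
  show ?thesis
  proof (rule that)
    show "test_fun \<Omega> (\<psi> j)" for j by fact
    show "L2_tendsto ?M \<psi> (\<lambda>x. max 0 (v x - k))"
      unfolding \<psi>_def
      using sq(1)[OF \<phi>] solution_square_integrable(1) lim(1) k less_imp_le[OF e] e_lim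
      by (rule smooth_truncation_L2_tendsto)
    show "r \<longlonglongrightarrow> 0"
      unfolding r_def
      using tendsto_add[OF tendsto_power[OF lim(2), of 2] tendsto_mult_left_zero[OF lim(2)]] by simp
    have "(\<integral>x. G x \<bullet> grad (\<psi> j) x \<partial>?M) = (\<integral>x. f x * \<psi> j x \<partial>?M)" for j
      using weak \<psi> by (auto simp: weak_solution_def)
    then show "(L2_norm ?M (grad (\<psi> j)))\<^sup>2 \<le> r j + B * (\<integral>x. \<bar>\<psi> j x\<bar> \<partial>?M)" for j
      using L2_norm_shrunk_power2_le
          [OF sq(2)[OF \<phi>] solution_square_integrable(2) sq(2)[OF \<psi>] shrunk, of j]
        source_pairing_le[OF \<psi>[of j]] by (simp add: r_def)
  qed
qed

private lemma truncation_Nash_inequality: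
  assumes k: "0 \<le> k" and R: "0 \<le> R"
  defines "V \<equiv> measure lborel (ball (0::'a) R)" and "w \<equiv> \<lambda>x. max 0 (v x - k)"
  shows "2 * V * (L2_norm (lebesgue_on \<Omega>) w)\<^sup>2
    \<le> V * R\<^sup>2 * (B * (\<integral>x. w x \<partial>lebesgue_on \<Omega>)) + 2 * (\<integral>x. w x \<partial>lebesgue_on \<Omega>)\<^sup>2"
proof -
  let ?M = "lebesgue_on \<Omega>"
  obtain \<psi> r where \<psi>: "\<And>j. test_fun \<Omega> (\<psi> j)"
    and lim: "L2_tendsto ?M \<psi> w" "r \<longlonglongrightarrow> 0"
    and energy: "\<And>j. (L2_norm ?M (grad (\<psi> j)))\<^sup>2 \<le> r j + B * (\<integral>x. \<bar>\<psi> j x\<bar> \<partial>?M)"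
    unfolding w_def using truncation_approximation[OF k] by blast
  note sq = test_fun_square_integrable(1)[OF \<psi> \<Omega>]
  have w: "square_integrable ?M w"
    unfolding w_def using k by (rule truncation_square_integrable)
  have ineq: "2 * V * (L2_norm ?M (\<psi> j))\<^sup>2
      \<le> V * R\<^sup>2 * (r j + B * (\<integral>x. \<bar>\<psi> j x\<bar> \<partial>?M)) + 2 * (\<integral>x. \<bar>\<psi> j x\<bar> \<partial>?M)\<^sup>2" for j
  proof -
    have "V * R\<^sup>2 * (L2_norm ?M (grad (\<psi> j)))\<^sup>2 \<le> V * R\<^sup>2 * (r j + B * (\<integral>x. \<bar>\<psi> j x\<bar> \<partial>?M))"
      using energy by (intro mult_left_mono) (auto simp: V_def)
    then show ?thesis
      using Nash_inequality_L2[OF \<psi>[of j] \<Omega> R] unfolding V_def by linarith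
  qed
  have L1: "(\<lambda>j. \<integral>x. \<bar>\<psi> j x\<bar> \<partial>?M) \<longlonglongrightarrow> (\<integral>x. w x \<partial>?M)"
    using integral_norm_tendsto[OF sq w lim(1)] by (simp add: w_def)
  have "2 * V * (L2_norm ?M w)\<^sup>2
      \<le> V * R\<^sup>2 * (0 + B * (\<integral>x. w x \<partial>?M)) + 2 * (\<integral>x. w x \<partial>?M)\<^sup>2"
  proof (rule LIMSEQ_le)
    show "(\<lambda>j. 2 * V * (L2_norm ?M (\<psi> j))\<^sup>2) \<longlonglongrightarrow> 2 * V * (L2_norm ?M w)\<^sup>2"
      by (intro tendsto_intros L2_norm_tendsto[OF sq w lim(1)])
    show "(\<lambda>j. V * R\<^sup>2 * (r j + B * (\<integral>x. \<bar>\<psi> j x\<bar> \<partial>?M)) + 2 * (\<integral>x. \<bar>\<psi> j x\<bar> \<partial>?M)\<^sup>2)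
        \<longlonglongrightarrow> V * R\<^sup>2 * (0 + B * (\<integral>x. w x \<partial>?M)) + 2 * (\<integral>x. w x \<partial>?M)\<^sup>2"
      by (intro tendsto_intros L1 lim(2))
  qed (use ineq in blast)
  then show ?thesis by simp
qed

text \<open>For a ball of volume \<open>2 b\<close> the left-hand side of the last inequality absorbs \<open>2 (\<integral> w)\<^sup>2\<close>.\<close>
private lemma truncation_integral_le:
  assumes k: "0 \<le> k" and b: "0 < b" and level: "superlevel_measure (lebesgue_on \<Omega>) v k \<le> b"
  shows "(\<integral>x. max 0 (v x - k) \<partial>lebesgue_on \<Omega>) \<le> b * (volume_radius TYPE('a) (2 * b))\<^sup>2 * B"
proof -
  let ?M = "lebesgue_on \<Omega>" and ?R = "volume_radius TYPE('a) (2 * b)"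
  note [measurable] = solution_square_integrable(1)
  define w where "w = (\<lambda>x. max 0 (v x - k))"
  define Y where "Y = (\<integral>x. w x \<partial>?M)"
  have Y: "0 \<le> Y" by (simp add: Y_def w_def)
  have "(\<integral>x. norm (w x) \<partial>?M) \<le> sqrt (superlevel_measure ?M v k) * L2_norm ?M w"
    unfolding w_def superlevel_measure_def
  proof (rule integral_norm_le_L2_norm_support[OF truncation_square_integrable[OF k]])
    show "{x\<in>space ?M. k < v x} \<in> sets ?M" by measurable
  qed auto
  also have "\<dots> \<le> sqrt b * L2_norm ?M w"
    using level by (intro mult_right_mono) auto
  finally have "Y\<^sup>2 \<le> (sqrt b * L2_norm ?M w)\<^sup>2"
    using Y by (intro power_mono) (auto simp: Y_def w_def)
  then have "4 * Y\<^sup>2 \<le> 2 * (2 * b) * (L2_norm ?M w)\<^sup>2"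
    using b by (simp add: power_mult_distrib)
  also have "\<dots> \<le> 2 * b * ?R\<^sup>2 * (B * Y) + 2 * Y\<^sup>2"
    using truncation_Nash_inequality[OF k, of ?R] b
    by (simp add: measure_ball_volume_radius volume_radius_pos less_imp_le Y_def w_def)
  finally have "Y * Y \<le> (b * ?R\<^sup>2 * B) * Y"
    by (simp add: power2_eq_square mult_ac)
  moreover have "0 \<le> b * ?R\<^sup>2 * B" using b B by simp
  ultimately have "Y \<le> b * ?R\<^sup>2 * B"
    using Y by (cases "Y = 0") auto
  then show ?thesis by (simp add: Y_def w_def)
qed

private lemma superlevel_measure_halving:
  assumes k: "0 \<le> k" and b: "0 < b" and level: "superlevel_measure (lebesgue_on \<Omega>) v k \<le> b"
  shows "superlevel_measure (lebesgue_on \<Omega>) v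
    (k + 2 * (volume_radius TYPE('a) (2 * b))\<^sup>2 * B) \<le> b / 2"
proof -
  let ?M = "lebesgue_on \<Omega>" and ?w = "\<lambda>x. max 0 (v x - k)"
  note [measurable] = solution_square_integrable(1)
  define t where "t = 2 * (volume_radius TYPE('a) (2 * b))\<^sup>2 * B"
  have t: "0 < t"
    using B b volume_radius_pos[of "2 * b", where 'a = 'a] by (simp add: t_def)
  have "superlevel_measure ?M v (k + t) \<le> measure ?M {x\<in>space ?M. t \<le> ?w x}"
    unfolding superlevel_measure_def
  proof (rule finite_measure_mono)
    show "{x\<in>space ?M. t \<le> ?w x} \<in> sets ?M" by measurable
  qed auto
  also have "\<dots> \<le> (\<integral>x. ?w x \<partial>?M) / t"
    using square_integrable_imp_integrable_norm[OF truncation_square_integrable[OF k]] t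
    by (intro integral_Markov_inequality_measure[where A = \<Omega>]) auto
  also have "\<dots> \<le> (b * (volume_radius TYPE('a) (2 * b))\<^sup>2 * B) / t"
    using truncation_integral_le[OF k b level] t by (intro divide_right_mono) auto
  also have "\<dots> = b / 2"
    using t by (auto simp: t_def)
  finally show ?thesis by (simp add: t_def)
qed

lemma weak_solution_bounded_above: "\<exists>K. AE x in lebesgue_on \<Omega>. v x \<le> K"
proof (rule AE_bounded_of_superlevel_measure_halving)
  let ?C = "2 * (2 / unit_ball_vol (real DIM('a))) powr (2 / DIM('a)) * B"
  show "v \<in> borel_measurable (lebesgue_on \<Omega>)"
    using solution_square_integrable(1) by (rule square_integrable_measurable)
  show "0 \<le> ?C" using B by simp
  show "0 < 2 / real DIM('a)" by simp
  fix k b :: real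
  assume "0 \<le> k" "0 < b" "superlevel_measure (lebesgue_on \<Omega>) v k \<le> b"
  from superlevel_measure_halving[OF this]
  show "superlevel_measure (lebesgue_on \<Omega>) v (k + ?C * b powr (2 / DIM('a))) \<le> b / 2"
    using \<open>0 < b\<close> by (simp add: volume_radius_power2 powr_mult powr_divide mult_ac)
qed

end

lemma weak_solution_uminus:
  assumes "\<Omega> \<in> lmeasurable" "weak_solution \<Omega> f v G"
  shows "weak_solution \<Omega> (\<lambda>x. - f x) (\<lambda>x. - v x) (\<lambda>x. - G x)"
  using assms H01_uminus by (auto simp: weak_solution_def)

theorem weak_solution_essentially_bounded:
  fixes \<Omega> :: "'a::euclidean_space set"
  assumes \<Omega>: "\<Omega> \<in> lmeasurable" and weak: "weak_solution \<Omega> f v G"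
    and f: "f \<in> borel_measurable (lebesgue_on \<Omega>)" "\<And>x. \<bar>f x\<bar> \<le> B" and B: "0 < B"
  shows "essentially_bounded (lebesgue_on \<Omega>) v"
  unfolding essentially_bounded_def
proof
  show "v \<in> borel_measurable (lebesgue_on \<Omega>)"
    using weak by (auto simp: weak_solution_def H01_def intro: measurable_restrict_space1)
  obtain K1 where "AE x in lebesgue_on \<Omega>. v x \<le> K1"
    using weak_solution_bounded_above[OF \<Omega> weak f B] by blast
  moreover obtain K2 where "AE x in lebesgue_on \<Omega>. - v x \<le> K2"
    using weak_solution_bounded_above[OF \<Omega> weak_solution_uminus[OF \<Omega> weak] _ _ B] f by auto
  ultimately have "AE x in lebesgue_on \<Omega>. \<bar>v x\<bar> \<le> max K1 K2"
    by eventually_elim auto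
  then show "\<exists>K. AE x in lebesgue_on \<Omega>. \<bar>v x\<bar> \<le> K" by blast
qed

section \<open>Left-continuity of the suprema\<close>

lemma torsion_weak_solution:
  fixes \<Omega> :: "'a::euclidean_space set"
  assumes \<Omega>: "\<Omega> \<in> lmeasurable"
  obtains G where "weak_solution \<Omega> (\<lambda>_. 1) (torsion \<Omega>) G"
proof -
  interpret finite_measure "lebesgue_on \<Omega>" using \<Omega> by (rule finite_measure_lebesgue_on)
  have "(LINT x:\<Omega>|lebesgue. g x) = (\<integral>x. g x \<partial>lebesgue_on \<Omega>)" for g :: "'a \<Rightarrow> real"
    using \<Omega> by (simp add: set_lebesgue_integral_def integral_restrict_space)
  then have "torsion \<Omega> = (SOME v. \<exists>G. weak_solution \<Omega> (\<lambda>_. 1) v G)"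
    by (simp add: torsion_def weak_solution_def)
  moreover obtain v G where "weak_solution \<Omega> (\<lambda>_. 1) v G"
    using weak_solution_exists[OF \<Omega> square_integrable_bounded[of "\<lambda>_. 1" 1]] by auto
  ultimately show ?thesis
    using that someI_ex[of "\<lambda>v. \<exists>G. weak_solution \<Omega> (\<lambda>_. 1) v G"] by auto
qed

lemma torsion_essentially_bounded:
  assumes "\<Omega> \<in> lmeasurable"
  shows "essentially_bounded (lebesgue_on \<Omega>) (torsion \<Omega>)"
proof -
  obtain G where "weak_solution \<Omega> (\<lambda>_. 1) (torsion \<Omega>) G"
    using torsion_weak_solution[OF assms] .
  then show ?thesis
    by (rule weak_solution_essentially_bounded[OF assms, where B = 1]) auto
qed

lemma torsion_measurable:
  assumes "\<Omega> \<in> lmeasurable"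
  shows "torsion \<Omega> \<in> borel_measurable lebesgue"
  using torsion_weak_solution[OF assms] by (metis weak_solution_def H01_def)

text \<open>Without a competitor \<open>lambda1\<close> would be the unspecified value \<open>Inf {}\<close>.\<close>
lemma lambda1_nonneg_or_AE_zero:
  fixes \<Omega> :: "'a::euclidean_space set"
  assumes \<Omega>: "\<Omega> \<in> lmeasurable" and H: "H01 \<Omega> u G"
  shows "0 \<le> lambda1 \<Omega> \<or> (AE x in lebesgue_on \<Omega>. u x = 0)"
proof -
  let ?Q = "{(LINT x:\<Omega>|lebesgue. (norm (G x))\<^sup>2) / (LINT x:\<Omega>|lebesgue. (u x)\<^sup>2) | u G.
    H01 \<Omega> u G \<and> (LINT x:\<Omega>|lebesgue. (u x)\<^sup>2) \<noteq> 0}"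
  show ?thesis
  proof (cases "?Q = {}")
    case True
    then have "(LINT x:\<Omega>|lebesgue. (u x)\<^sup>2) = 0" using H by auto
    then have "(\<integral>x. (u x)\<^sup>2 \<partial>lebesgue_on \<Omega>) = 0"
      using \<Omega> by (simp add: set_lebesgue_integral_def integral_restrict_space)
    moreover have "integrable (lebesgue_on \<Omega>) (\<lambda>x. (u x)\<^sup>2)"
      using H square_integrableD[of "lebesgue_on \<Omega>" u] by (simp add: H01_iff[OF \<Omega>])
    ultimately have "AE x in lebesgue_on \<Omega>. (u x)\<^sup>2 = 0"
      by (simp add: integral_nonneg_eq_0_iff_AE)
    then show ?thesis by simp
  next
    case False
    then have "0 \<le> Inf ?Q"
      by (rule cInf_greatest) (auto simp: set_lebesgue_integral_def)
    then show ?thesis by (simp add: lambda1_def)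
  qed
qed

lemma integral_uniform_measure:
  fixes f :: "'a \<Rightarrow> 'b::{banach, second_countable_topology}"
  assumes [measurable]: "f \<in> borel_measurable M" "S \<in> sets M"
    and S: "emeasure M S \<noteq> \<infinity>" "measure M S \<noteq> 0"
  shows "(\<integral>x. f x \<partial>uniform_measure M S) = (\<integral>x\<in>S. f x \<partial>M) /\<^sub>R measure M S"
proof -
  have "emeasure M S = ennreal (measure M S)"
    using S(1) by (simp add: emeasure_eq_ennreal_measure)
  moreover have "0 < measure M S"
    using S(2) by (simp add: zero_less_measure_iff)
  ultimately have "uniform_measure M S = density M (\<lambda>x. ennreal (indicator S x / measure M S))"
    unfolding uniform_measure_def
    by (auto simp: divide_ennreal ennreal_indicator[symmetric]
        intro!: arg_cong[where f = "density M"])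
  then have "(\<integral>x. f x \<partial>uniform_measure M S) = (\<integral>x. (indicator S x / measure M S) *\<^sub>R f x \<partial>M)"
    by (simp add: integral_density)
  also have "\<dots> = (\<integral>x. inverse (measure M S) *\<^sub>R (indicator S x *\<^sub>R f x) \<partial>M)"
    by (simp add: divide_inverse mult.commute)
  finally show ?thesis
    by (simp only: set_lebesgue_integral_def integral_scaleR_right)
qed

context
  fixes \<Omega> :: "'a::euclidean_space set"
  assumes \<Omega>: "\<Omega> \<in> lmeasurable" "measure lebesgue \<Omega> \<noteq> 0"
begin

private abbreviation (input) "U \<equiv> uniform_measure lebesgue \<Omega>"

private lemma emeasure_bounds: "emeasure lebesgue \<Omega> \<noteq> 0" "emeasure lebesgue \<Omega> < \<infinity>"
  using \<Omega> by (auto simp: measure_def fmeasurable_def)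

interpretation U: prob_space U
  using emeasure_bounds by (intro prob_space_uniform_measure) auto

private lemma AE_U_iff: "(AE x in U. P x) \<longleftrightarrow> (AE x in lebesgue. x \<in> \<Omega> \<longrightarrow> P x)"
  using emeasure_bounds by (rule AE_uniform_measure)

lemma Linf_norm_eq_power_mean:
  assumes [measurable]: "v \<in> borel_measurable lebesgue"
  shows "Linf_norm \<Omega> v = power_mean (uniform_measure lebesgue \<Omega>) \<infinity> v"
proof -
  let ?f = "\<lambda>x. ereal (indicator \<Omega> x * \<bar>v x\<bar>)"
  note [measurable] = fmeasurableD[OF \<Omega>(1)]
  have "(AE x in lebesgue. ?f x \<le> a) \<longleftrightarrow> (AE x in U. ereal \<bar>v x\<bar> \<le> a)" for a
  proof
    assume "AE x in lebesgue. ?f x \<le> a"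
    then have "AE x in lebesgue. x \<in> \<Omega> \<longrightarrow> ereal \<bar>v x\<bar> \<le> a"
      by eventually_elim (auto split: split_indicator_asm)
    then show "AE x in U. ereal \<bar>v x\<bar> \<le> a"
      by (simp add: AE_U_iff)
  next
    assume a: "AE x in U. ereal \<bar>v x\<bar> \<le> a"
    then obtain x where "ereal \<bar>v x\<bar> \<le> a"
      using U.AE_contr by fastforce
    then have "0 \<le> a" by (rule order_trans[rotated]) simp
    moreover have "AE x in lebesgue. x \<in> \<Omega> \<longrightarrow> ereal \<bar>v x\<bar> \<le> a"
      using a by (simp add: AE_U_iff)
    ultimately show "AE x in lebesgue. ?f x \<le> a"
      by (auto elim!: eventually_mono simp: zero_ereal_def[symmetric] split: split_indicator)
  qed
  then have "esssup lebesgue ?f = esssup U (\<lambda>x. ereal \<bar>v x\<bar>)"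
    by (simp add: esssup_eq_AE)
  then show ?thesis by (simp add: Linf_norm_def power_mean_def)
qed

lemma Lp_norm_div_eq_power_mean:
  assumes "v \<in> borel_measurable lebesgue"
  shows "Lp_norm p \<Omega> v / measure lebesgue \<Omega> powr (1 / p)
    = power_mean (uniform_measure lebesgue \<Omega>) (ereal p) v"
proof -
  have "(\<integral>x. \<bar>v x\<bar> powr p \<partial>U) = (LINT x:\<Omega>|lebesgue. \<bar>v x\<bar> powr p) / measure lebesgue \<Omega>"
    using \<Omega> assms
    by (subst integral_uniform_measure) (auto simp: fmeasurable_def divide_inverse mult.commute)
  moreover have "0 \<le> (LINT x:\<Omega>|lebesgue. \<bar>v x\<bar> powr p)"
    by (simp add: set_lebesgue_integral_def)
  ultimately show ?thesis
    by (simp add: power_mean_ereal Lp_norm_def powr_divide)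
qed

lemma Ffun_eq_power_mean:
  assumes "0 < p"
  shows "Ffun p \<Omega> = power_mean (uniform_measure lebesgue \<Omega>) p (torsion \<Omega>) * lambda1 \<Omega>"
  using assms Linf_norm_eq_power_mean[OF torsion_measurable[OF \<Omega>(1)]]
    Lp_norm_div_eq_power_mean[OF torsion_measurable[OF \<Omega>(1)], symmetric]
  by (cases p) (simp_all add: Ffun_def)

private lemma AE_lebesgue_on_iff: "(AE x in lebesgue_on \<Omega>. P x) \<longleftrightarrow> (AE x in U. P x)"
  using \<Omega> by (simp add: AE_U_iff AE_restrict_space_iff)

private lemma torsion_essentially_bounded_U: "essentially_bounded U (torsion \<Omega>)"
  using torsion_essentially_bounded[OF \<Omega>(1)] torsion_measurable[OF \<Omega>(1)]
  by (simp add: essentially_bounded_def AE_lebesgue_on_iff)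

lemma Ffun_mono:
  assumes q: "0 < q" "q \<le> p"
  shows "Ffun q \<Omega> \<le> Ffun p \<Omega>"
proof -
  have p: "0 < p" using q by (rule less_le_trans)
  note bounded = torsion_essentially_bounded_U
  obtain G where "H01 \<Omega> (torsion \<Omega>) G"
    using torsion_weak_solution[OF \<Omega>(1)] by (auto simp: weak_solution_def)
  from lambda1_nonneg_or_AE_zero[OF \<Omega>(1) this]
  consider (nonneg) "0 \<le> lambda1 \<Omega>" | (null) "AE x in U. torsion \<Omega> x = 0"
    by (auto simp: AE_lebesgue_on_iff)
  then show ?thesis
  proof cases
    case nonneg
    then show ?thesis
      using U.power_mean_mono[OF bounded q] p q by (simp add: Ffun_eq_power_mean mult_right_mono)
  next
    case null
    then have "AE x in U. \<bar>torsion \<Omega> x\<bar> \<le> 0" by eventually_elim simp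
    then have "power_mean U r (torsion \<Omega>) = 0" if "0 < r" for r
      using U.power_mean_le[OF bounded _ that] U.power_mean_nonneg[OF bounded, of r]
      by (simp add: order_antisym)
    then show ?thesis using p q by (simp add: Ffun_eq_power_mean)
  qed
qed

lemma Ffun_tendsto_at_left:
  assumes p: "0 < p"
  shows "((\<lambda>q. Ffun q \<Omega>) \<longlongrightarrow> Ffun p \<Omega>) (at_left p)"
proof -
  have "((\<lambda>q. power_mean U q (torsion \<Omega>) * lambda1 \<Omega>) \<longlongrightarrow> Ffun p \<Omega>) (at_left p)"
    unfolding Ffun_eq_power_mean[OF p]
    by (intro tendsto_intros U.power_mean_tendsto_at_left torsion_essentially_bounded_U p)
  moreover have "\<forall>\<^sub>F q in at_left p. power_mean U q (torsion \<Omega>) * lambda1 \<Omega> = Ffun q \<Omega>"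
    unfolding eventually_at_left[OF p] by (intro exI[of _ 0]) (simp add: p Ffun_eq_power_mean)
  ultimately show ?thesis by (rule Lim_transform_eventually)
qed

end

lemma tendsto_SUP_at_left:
  fixes F :: "'a \<Rightarrow> 'b::linorder_topology \<Rightarrow> 'c::{complete_linorder, linorder_topology}"
  assumes "c < p"
    and mono: "\<And>x q. x \<in> S \<Longrightarrow> c < q \<Longrightarrow> q \<le> p \<Longrightarrow> F x q \<le> F x p"
    and lim: "\<And>x. x \<in> S \<Longrightarrow> (F x \<longlongrightarrow> F x p) (at_left p)"
  shows "((\<lambda>q. SUP x\<in>S. F x q) \<longlongrightarrow> (SUP x\<in>S. F x p)) (at_left p)"
proof (rule order_tendstoI)
  fix a assume "a < (SUP x\<in>S. F x p)"
  then obtain x where x: "x \<in> S" "a < F x p" by (auto simp: less_SUP_iff)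
  from order_tendstoD(1)[OF lim[OF x(1)] x(2)]
  show "\<forall>\<^sub>F q in at_left p. a < (SUP x\<in>S. F x q)"
    by eventually_elim (use x(1) in \<open>auto simp: less_SUP_iff\<close>)
next
  fix a assume a: "(SUP x\<in>S. F x p) < a"
  have "\<forall>\<^sub>F q in at_left p. c < q \<and> q < p"
    unfolding eventually_at_left[OF \<open>c < p\<close>] using \<open>c < p\<close> by auto
  then show "\<forall>\<^sub>F q in at_left p. (SUP x\<in>S. F x q) < a"
  proof eventually_elim
    case (elim q)
    then have "(SUP x\<in>S. F x q) \<le> (SUP x\<in>S. F x p)"
      using mono by (intro SUP_mono) force
    then show ?case using a by (rule le_less_trans)
  qed
qed

lemma SUP_Ffun_tendsto_at_left:
  assumes p: "0 < p"
    and S: "\<And>\<Omega>. \<Omega> \<in> S \<Longrightarrow> open \<Omega> \<and> 0 < emeasure lebesgue \<Omega> \<and> emeasure lebesgue \<Omega> < \<infinity>"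
  shows "((\<lambda>q. SUP \<Omega>\<in>S. ereal (Ffun q \<Omega>)) \<longlongrightarrow> (SUP \<Omega>\<in>S. ereal (Ffun p \<Omega>))) (at_left p)"
proof (rule tendsto_SUP_at_left[OF p])
  have admissible: "\<Omega> \<in> lmeasurable" "measure lebesgue \<Omega> \<noteq> 0" if "\<Omega> \<in> S" for \<Omega>
    using S[OF that] by (auto simp: measure_def enn2real_eq_0_iff intro!: fmeasurableI)
  show "ereal (Ffun q \<Omega>) \<le> ereal (Ffun p \<Omega>)" if "\<Omega> \<in> S" "0 < q" "q \<le> p" for \<Omega> q
    using Ffun_mono[OF admissible[OF that(1)] that(2,3)] by simp
  show "((\<lambda>q. ereal (Ffun q \<Omega>)) \<longlongrightarrow> ereal (Ffun p \<Omega>)) (at_left p)" if "\<Omega> \<in> S" for \<Omega>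
    using Ffun_tendsto_at_left[OF admissible[OF that] p] by (rule tendsto_ereal)
qed

theorem theorem3:
  assumes "DIM('a::euclidean_space) \<ge> 2"
  shows "(\<forall>p::ereal. 1 < p \<longrightarrow>
           ((Frak TYPE('a) \<longlongrightarrow> Frak TYPE('a) p) (at_left p) \<and>
            (Frak_convex TYPE('a) \<longlongrightarrow> Frak_convex TYPE('a) p) (at_left p))) \<and>
         ((\<lambda>q::real. Frak TYPE('a) (ereal q)) \<longlongrightarrow> Frak TYPE('a) \<infinity>) at_top"
proof -
  have left: "(Frak TYPE('a) \<longlongrightarrow> Frak TYPE('a) p) (at_left p)"
    "(Frak_convex TYPE('a) \<longlongrightarrow> Frak_convex TYPE('a) p) (at_left p)" if "1 < p" for p
  proof -
    have "0 < p" using that by (rule less_trans[rotated]) simp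
    then show "(Frak TYPE('a) \<longlongrightarrow> Frak TYPE('a) p) (at_left p)"
      "(Frak_convex TYPE('a) \<longlongrightarrow> Frak_convex TYPE('a) p) (at_left p)"
      unfolding Frak_def Frak_convex_def by (auto intro!: SUP_Ffun_tendsto_at_left)
  qed
  have "(Frak TYPE('a) \<longlongrightarrow> Frak TYPE('a) \<infinity>) (at_left \<infinity>)"
    by (rule left(1)) simp
  then have "((\<lambda>q::real. Frak TYPE('a) (ereal q)) \<longlongrightarrow> Frak TYPE('a) \<infinity>) at_top"
    by (simp add: at_left_PInf filterlim_filtermap)
  then show ?thesis using left by blast
qed

end
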